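(* Let $(M,J)$ be a compact, connected, almost complex manifold of (real) dimension $2n$ with second Betti number $b_2$, first Chern class $c_1$ and index $k_0$. Let $\{\tau_1,\ldots,\tau_{b_2}\}$ be a basis of $\mathcal L=H^2(M;\mathbb Z)/\operatorname{Tor}(H^2(M;\mathbb Z))$ such that $$c_1=\sum_{i=1}^{b_2}n_i\tau_i$$ for some positive integers $n_i\in\mathbb Z_{>0}$. For $i=1,\ldots,b_2$ define $\eta_i:=\frac{n_i}{k_0}\tau_i\in\mathcal L$ and assume that the index map $\widetilde H\colon\mathcal L\to\mathbb Z$ satisfies $\widetilde H(-c_1)\ne 0$ and $$\widetilde H(-k_1\eta_1-\cdots-k_{b_2}\eta_{b_2})=0$$ for all $k_1,\ldots,k_{b_2}\in\mathbb Z$ such that $0<k_i\le k_0$ for all $i=1,\ldots,b_2$ and $\sum_{i=1}^{b_2}k_i<k_0b_2$. Let $\mathrm H\in\mathbb Q[z_1,\ldots,z_{b_2}]$ be the generalized Hilbert polynomial. Then $(M,J)$ satisfies the Mukai inequality; more precisely, $$n\ \ge\ \deg(\mathrm H)\ \ge\ b_2(k_0-1).$$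
   Context: For a compact, connected almost complex manifold $(M,J)$ of real dimension $2n$, $c_1$ denotes the first Chern class of $(TM,J)$, regarded in $\mathcal L$. The index $k_0$ of $(M,J)$ is the largest integer with $c_1=k_0\eta$, modulo torsion, for some primitive $\eta\in H^2(M;\mathbb Z)$; if $c_1=\sum n_i\tau_i$ as in the claim, then $k_0=\gcd(n_1,\ldots,n_{b_2})$. The index map $\widetilde H$ sends $\eta\in H^2(M;\mathbb Z)$ to the Atiyah-Singer index $\operatorname{Ind}(e^{2\pi\mathrm i\eta})$ of the complex line bundle $e^{2\pi\mathrm i\eta}$ with first Chern class $\eta$; by the index formula $\widetilde H(\eta)=\big(\sum_{l\ge 0}\eta^l/l!\big)\,\mathcal T[M]$, where $\mathcal T$ is the total Todd class of $(M,J)$. It depends only on the class of $\eta$ modulo torsion, hence induces a map $\widetilde H\colon\mathcal L\to\mathbb Z$. The generalized Hilbert polynomial (with respect to the basis $\tau_1,\ldots,\tau_{b_2}$) is the unique polynomial $\mathrm H\in\mathbb Q[z_1,\ldots,z_{b_2}]$ with $\mathrm H(k_1,\ldots,k_{b_2})=\widetilde H(k_1\tau_1+\cdots+k_{b_2}\tau_{b_2})$ for all $(k_1,\ldots,k_{b_2})\in\mathbb Z^{b_2}$. The Mukai inequality is $n\ge b_2(k_0-1)$. *)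

theory Defs
  imports
    "HOL-Analysis.Analysis"
    "HOL-Homology.Homology"
    "HOL-Combinatorics.Permutations"
    "HOL-Computational_Algebra.Formal_Power_Series"
    "HOL-Library.Poly_Mapping"
begin

section \<open>Singular cohomology with its cup product\<close>

type_synonym ('a, 'r) cochain = "((nat \<Rightarrow> real) \<Rightarrow> 'a) \<Rightarrow> 'r"

text \<open>A cochain of degree \<open>p\<close> on \<open>X\<close> is a function on the singular \<open>p\<close>-simplices of \<open>X\<close>, extended
  by zero to all other arguments so that equality of cochains is equality of functions.\<close>

definition cochains :: "nat \<Rightarrow> 'a topology \<Rightarrow> ('a, 'r::comm_ring_1) cochain set" where
  "cochains p X = {\<phi>. \<forall>\<sigma>. \<not> singular_simplex p X \<sigma> \<longrightarrow> \<phi> \<sigma> = 0}"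

definition coboundary :: "nat \<Rightarrow> 'a topology \<Rightarrow> ('a, 'r::comm_ring_1) cochain \<Rightarrow> ('a, 'r) cochain" where
  "coboundary p X \<phi> = (\<lambda>\<sigma>. if singular_simplex (Suc p) X \<sigma>
      then \<Sum>k\<le>Suc p. (-1) ^ k * \<phi> (singular_face (Suc p) k \<sigma>) else 0)"

definition cocycles :: "nat \<Rightarrow> 'a topology \<Rightarrow> ('a, 'r::comm_ring_1) cochain set" where
  "cocycles p X = {\<phi> \<in> cochains p X. \<forall>\<sigma>. coboundary p X \<phi> \<sigma> = 0}"

definition coboundaries :: "nat \<Rightarrow> 'a topology \<Rightarrow> ('a, 'r::comm_ring_1) cochain set" where
  "coboundaries p X =
     (if p = 0 then {\<lambda>\<sigma>. 0} else coboundary (p - 1) X ` cochains (p - 1) X)"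

definition cocycle_group :: "nat \<Rightarrow> 'a topology \<Rightarrow> ('a, int) cochain monoid" where
  "cocycle_group p X = \<lparr>carrier = cocycles p X, monoid.mult = (\<lambda>\<phi> \<psi> \<sigma>. \<phi> \<sigma> + \<psi> \<sigma>), one = (\<lambda>\<sigma>. 0)\<rparr>"

definition cohomology_group :: "nat \<Rightarrow> 'a topology \<Rightarrow> ('a, int) cochain set monoid" where
  "cohomology_group p X = cocycle_group p X Mod coboundaries p X"

definition front_face :: "nat \<Rightarrow> ((nat \<Rightarrow> real) \<Rightarrow> 'a) \<Rightarrow> (nat \<Rightarrow> real) \<Rightarrow> 'a" where
  "front_face p \<sigma> = restrict \<sigma> (standard_simplex p)"

definition back_face :: "nat \<Rightarrow> nat \<Rightarrow> ((nat \<Rightarrow> real) \<Rightarrow> 'a) \<Rightarrow> (nat \<Rightarrow> real) \<Rightarrow> 'a" where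
  "back_face p q \<sigma> = restrict (\<lambda>x. \<sigma> (\<lambda>i. if i < p then 0 else x (i - p))) (standard_simplex q)"

definition cup :: "nat \<Rightarrow> nat \<Rightarrow> 'a topology \<Rightarrow>
    ('a, 'r::comm_ring_1) cochain \<Rightarrow> ('a, 'r) cochain \<Rightarrow> ('a, 'r) cochain" where
  "cup p q X \<phi> \<psi> = (\<lambda>\<sigma>. if singular_simplex (p + q) X \<sigma>
      then \<phi> (front_face p \<sigma>) * \<psi> (back_face p q \<sigma>) else 0)"

definition unit_cochain :: "'a topology \<Rightarrow> ('a, 'r::comm_ring_1) cochain" where
  "unit_cochain X = (\<lambda>\<sigma>. if singular_simplex 0 X \<sigma> then 1 else 0)"

text \<open>The product of a list of cochains, each of them paired with its degree.\<close>

fun cup_list :: "'a topology \<Rightarrow> (nat \<times> ('a, 'r::comm_ring_1) cochain) list \<Rightarrow> ('a, 'r) cochain" where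
  "cup_list X [] = unit_cochain X"
| "cup_list X ((p, \<phi>) # xs) = cup p (sum_list (map fst xs)) X \<phi> (cup_list X xs)"

definition pullback :: "nat \<Rightarrow> 'a topology \<Rightarrow> ('a \<Rightarrow> 'b) \<Rightarrow> ('b, 'r::comm_ring_1) cochain \<Rightarrow> ('a, 'r) cochain" where
  "pullback p X f \<phi> = (\<lambda>\<sigma>. if singular_simplex p X \<sigma> then \<phi> (simplex_map p f \<sigma>) else 0)"

definition evaluate :: "('a, 'r::comm_ring_1) cochain \<Rightarrow> 'a chain \<Rightarrow> 'r" where
  "evaluate \<phi> \<mu> = (\<Sum>\<sigma>\<in>Poly_Mapping.keys \<mu>. of_int (Poly_Mapping.lookup \<mu> \<sigma>) * \<phi> \<sigma>)"

definition coeff_rat :: "('a, int) cochain \<Rightarrow> ('a, rat) cochain" where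
  "coeff_rat \<phi> = (\<lambda>\<sigma>. of_int (\<phi> \<sigma>))"


section \<open>Abelian groups modulo torsion\<close>

text \<open>As in \<open>HOL-Homology\<close>, abelian groups are written multiplicatively.\<close>

definition torsion :: "('g, 'm) monoid_scheme \<Rightarrow> 'g set" where
  "torsion G = {x \<in> carrier G. \<exists>m::nat. 0 < m \<and> x [^]\<^bsub>G\<^esub> m = \<one>\<^bsub>G\<^esub>}"

definition int_combination :: "('g, 'm) monoid_scheme \<Rightarrow> nat \<Rightarrow> (nat \<Rightarrow> 'g) \<Rightarrow> (nat \<Rightarrow> int) \<Rightarrow> 'g" where
  "int_combination G b \<tau> k = finprod G (\<lambda>i. \<tau> i [^]\<^bsub>G\<^esub> k i) {..<b}"

definition is_basis :: "('g, 'm) monoid_scheme \<Rightarrow> nat \<Rightarrow> (nat \<Rightarrow> 'g) \<Rightarrow> bool" where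
  "is_basis G b \<tau> \<longleftrightarrow> (\<forall>i<b. \<tau> i \<in> carrier G) \<and>
     (\<forall>x\<in>carrier G. \<exists>!k. k \<in> extensional {..<b} \<and> x = int_combination G b \<tau> k)"

definition group_rank :: "('g, 'm) monoid_scheme \<Rightarrow> nat" where
  "group_rank G = (GREATEST r. \<exists>g. (\<forall>i<r. g i \<in> carrier G) \<and>
     (\<forall>k. int_combination G r g k = \<one>\<^bsub>G\<^esub> \<longrightarrow> (\<forall>i<r. k i = 0)))"

definition primitive :: "('g, 'm) monoid_scheme \<Rightarrow> 'g \<Rightarrow> bool" where
  "primitive G x \<longleftrightarrow> x \<in> carrier G \<and>
     (\<forall>y\<in>carrier G. \<forall>m::int. x = y [^]\<^bsub>G\<^esub> m \<longrightarrow> \<bar>m\<bar> = 1)"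

definition betti_number :: "nat \<Rightarrow> 'a topology \<Rightarrow> nat" where
  "betti_number p X = group_rank (homology_group (int p) X)"

definition H2_mod_torsion :: "'a topology \<Rightarrow> ('a, int) cochain set set monoid" where
  "H2_mod_torsion X = cohomology_group 2 X Mod torsion (cohomology_group 2 X)"

definition class_mod_torsion :: "'a topology \<Rightarrow> ('a, int) cochain \<Rightarrow> ('a, int) cochain set set" where
  "class_mod_torsion X z =
     torsion (cohomology_group 2 X) #>\<^bsub>cohomology_group 2 X\<^esub>
       (coboundaries 2 X #>\<^bsub>cocycle_group 2 X\<^esub> z)"


section \<open>Smooth manifolds and almost complex structures\<close>

text \<open>The model space is the library's \<open>Euclidean_space m\<close>, whose points are the sequences vanishing
  from index \<open>m\<close> on.\<close>

definition partial_deriv :: "nat \<Rightarrow> ((nat \<Rightarrow> real) \<Rightarrow> real) \<Rightarrow> (nat \<Rightarrow> real) \<Rightarrow> real" where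
  "partial_deriv i f x = deriv (\<lambda>t. f (x(i := t))) (x i)"

primrec ck_on :: "nat \<Rightarrow> nat \<Rightarrow> (nat \<Rightarrow> real) set \<Rightarrow> ((nat \<Rightarrow> real) \<Rightarrow> real) \<Rightarrow> bool" where
  "ck_on m 0 U f \<longleftrightarrow> continuous_map (subtopology (Euclidean_space m) U) euclideanreal f"
| "ck_on m (Suc k) U f \<longleftrightarrow> continuous_map (subtopology (Euclidean_space m) U) euclideanreal f \<and>
     (\<forall>i<m. (\<forall>x\<in>U. (\<lambda>t. f (x(i := t))) differentiable at (x i)) \<and> ck_on m k U (partial_deriv i f))"

definition smooth_on :: "nat \<Rightarrow> (nat \<Rightarrow> real) set \<Rightarrow> ((nat \<Rightarrow> real) \<Rightarrow> real) \<Rightarrow> bool" where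
  "smooth_on m U f \<longleftrightarrow> (\<forall>k. ck_on m k U f)"

text \<open>A chart is its domain together with its coordinate map.\<close>

type_synonym 'a chart = "'a set \<times> ('a \<Rightarrow> nat \<Rightarrow> real)"

definition chart_image :: "'a chart \<Rightarrow> (nat \<Rightarrow> real) set" where
  "chart_image c = snd c ` fst c"

definition chart_inv :: "'a chart \<Rightarrow> (nat \<Rightarrow> real) \<Rightarrow> 'a" where
  "chart_inv c = inv_into (fst c) (snd c)"

definition smooth_manifold :: "nat \<Rightarrow> 'a topology \<Rightarrow> 'a chart set \<Rightarrow> bool" where
  "smooth_manifold m X A \<longleftrightarrow>
     Hausdorff_space X \<and>
     second_countable X \<and>
     (\<Union>c\<in>A. fst c) = topspace X \<and>
     (\<forall>c\<in>A. openin X (fst c) \<and> openin (Euclidean_space m) (chart_image c) \<and>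
        homeomorphic_map (subtopology X (fst c)) (subtopology (Euclidean_space m) (chart_image c)) (snd c)) \<and>
     (\<forall>c\<in>A. \<forall>c'\<in>A. \<forall>i<m.
        smooth_on m (snd c ` (fst c \<inter> fst c')) (\<lambda>x. snd c' (chart_inv c x) i))"

definition mat_vec :: "nat \<Rightarrow> (nat \<Rightarrow> nat \<Rightarrow> real) \<Rightarrow> (nat \<Rightarrow> real) \<Rightarrow> nat \<Rightarrow> real" where
  "mat_vec m a v = (\<lambda>i. if i < m then \<Sum>j<m. a i j * v j else 0)"

text \<open>The Jacobian matrix at \<open>p\<close> of the coordinate change from \<open>c\<close> to \<open>c'\<close>.\<close>

definition jacobian :: "'a chart \<Rightarrow> 'a chart \<Rightarrow> 'a \<Rightarrow> nat \<Rightarrow> nat \<Rightarrow> real" where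
  "jacobian c c' p i j = partial_deriv j (\<lambda>x. snd c' (chart_inv c x) i) (snd c p)"

text \<open>A tangent vector at \<open>p\<close> assigns to every chart around \<open>p\<close> its coordinate vector, subject to the
  usual transformation rule; to the remaining arguments it assigns \<open>0\<close>.\<close>

definition tangent_space :: "nat \<Rightarrow> 'a chart set \<Rightarrow> 'a \<Rightarrow> ('a chart \<Rightarrow> nat \<Rightarrow> real) set" where
  "tangent_space m A p = {v. \<forall>c.
     if c \<in> A \<and> p \<in> fst c
     then v c \<in> topspace (Euclidean_space m) \<and>
          (\<forall>c'\<in>A. p \<in> fst c' \<longrightarrow> v c' = mat_vec m (jacobian c c' p) (v c))
     else v c = (\<lambda>i. 0)}"

definition tangent_topology ::
    "nat \<Rightarrow> 'a topology \<Rightarrow> 'a chart set \<Rightarrow> ('a \<times> ('a chart \<Rightarrow> nat \<Rightarrow> real)) topology" where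
  "tangent_topology m X A = topology_generated_by
     {{(p, v). p \<in> fst c \<and> v \<in> tangent_space m A p \<and> (snd c p, v c) \<in> W} | c W.
        c \<in> A \<and> openin (prod_topology (Euclidean_space m) (Euclidean_space m)) W}"

text \<open>An almost complex structure is given by its component matrices: \<open>J c p\<close> is the matrix at \<open>p\<close>
  with respect to the chart \<open>c\<close>.\<close>

type_synonym 'a endo_field = "'a chart \<Rightarrow> 'a \<Rightarrow> nat \<Rightarrow> nat \<Rightarrow> real"

definition almost_complex_structure :: "nat \<Rightarrow> 'a chart set \<Rightarrow> 'a endo_field \<Rightarrow> bool" where
  "almost_complex_structure m A J \<longleftrightarrow>
     (\<forall>c\<in>A. \<forall>i<m. \<forall>j<m. smooth_on m (chart_image c) (\<lambda>x. J c (chart_inv c x) i j)) \<and>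
     (\<forall>c\<in>A. \<forall>p\<in>fst c. \<forall>i<m. \<forall>j<m.
        (\<Sum>k<m. J c p i k * J c p k j) = (if i = j then - 1 else 0)) \<and>
     (\<forall>c\<in>A. \<forall>c'\<in>A. \<forall>p\<in>fst c \<inter> fst c'. \<forall>i<m. \<forall>j<m.
        (\<Sum>k<m. jacobian c c' p i k * J c p k j) = (\<Sum>k<m. J c' p i k * jacobian c c' p k j))"


section \<open>Chern classes\<close>

text \<open>The data of a complex vector bundle that enter the construction of its Chern classes.\<close>

record ('b, 'e) cbundle =
  base :: "'b topology"
  total :: "'e topology"
  bproj :: "'e \<Rightarrow> 'b"
  scale :: "complex \<Rightarrow> 'e \<Rightarrow> 'e"

definition tangent_bundle :: "nat \<Rightarrow> 'a topology \<Rightarrow> 'a chart set \<Rightarrow> 'a endo_field \<Rightarrow>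
    ('a, 'a \<times> ('a chart \<Rightarrow> nat \<Rightarrow> real)) cbundle" where
  "tangent_bundle m X A J =
     \<lparr>base = X, total = tangent_topology m X A, bproj = fst,
      scale = (\<lambda>z (p, v). (p, \<lambda>c i. Re z * v c i + Im z * mat_vec m (J c p) (v c) i))\<rparr>"

definition nonzero_vectors :: "('b, 'e, 'z) cbundle_scheme \<Rightarrow> 'e set" where
  "nonzero_vectors E = {v \<in> topspace (total E). scale E 0 v \<noteq> v}"

definition zero_section :: "('b, 'e, 'z) cbundle_scheme \<Rightarrow> 'b \<Rightarrow> 'e" where
  "zero_section E b = (THE v. v \<in> topspace (total E) \<and> bproj E v = b \<and> scale E 0 v = v)"

text \<open>The triangle with vertices \<open>v\<close>, \<open>\<omega> v\<close>, \<open>\<omega>\<^sup>2 v\<close>, where \<open>\<omega>\<close> is the primitive third root of unity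
  in the upper half plane. For a complex line it is a positively oriented relative simplex that
  generates the second homology of the line modulo the nonzero vectors.\<close>

definition fibre_triangle :: "('b, 'e, 'z) cbundle_scheme \<Rightarrow> 'e \<Rightarrow> (nat \<Rightarrow> real) \<Rightarrow> 'e" where
  "fibre_triangle E v = restrict
     (\<lambda>x. scale E (of_real (x 0) + of_real (x 1) * cis (2 * pi / 3) + of_real (x 2) * cis (4 * pi / 3)) v)
     (standard_simplex 2)"

text \<open>The first Chern class of a complex line bundle is its Euler class: the pullback along the zero
  section of the Thom class \<open>u\<close>, a cocycle relative to the nonzero vectors that takes the value \<open>1\<close> on
  the positive generator of every fibre.\<close>

definition line_bundle_chern_cocycle :: "('b, 'e, 'z) cbundle_scheme \<Rightarrow> ('b, int) cochain \<Rightarrow> bool" where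
  "line_bundle_chern_cocycle E t \<longleftrightarrow> t \<in> cocycles 2 (base E) \<and>
     (\<exists>u \<in> cocycles 2 (total E).
        (\<forall>\<sigma>. singular_simplex 2 (subtopology (total E) (nonzero_vectors E)) \<sigma> \<longrightarrow> u \<sigma> = 0) \<and>
        (\<forall>v\<in>nonzero_vectors E. u (fibre_triangle E v) = 1) \<and>
        (\<lambda>\<sigma>. t \<sigma> - pullback 2 (base E) (zero_section E) u \<sigma>) \<in> coboundaries 2 (base E))"

definition quotient_topology :: "'a topology \<Rightarrow> ('a \<Rightarrow> 'b) \<Rightarrow> 'b topology" where
  "quotient_topology X f =
     topology (\<lambda>U. U \<subseteq> f ` topspace X \<and> openin X {x \<in> topspace X. f x \<in> U})"

lemma openin_quotient_topology:
  "openin (quotient_topology X f) U \<longleftrightarrow>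
     U \<subseteq> f ` topspace X \<and> openin X {x \<in> topspace X. f x \<in> U}"
proof -
  have "istopology (\<lambda>U. U \<subseteq> f ` topspace X \<and> openin X {x \<in> topspace X. f x \<in> U})"
    unfolding istopology_def
  proof (intro conjI allI impI; (elim conjE)?)
    fix S T
    assume S: "S \<subseteq> f ` topspace X" "openin X {x \<in> topspace X. f x \<in> S}"
      and T: "T \<subseteq> f ` topspace X" "openin X {x \<in> topspace X. f x \<in> T}"
    show "S \<inter> T \<subseteq> f ` topspace X" using S by blast
    have "{x \<in> topspace X. f x \<in> S \<inter> T} = {x \<in> topspace X. f x \<in> S} \<inter> {x \<in> topspace X. f x \<in> T}"
      by blast
    then show "openin X {x \<in> topspace X. f x \<in> S \<inter> T}" using S T by auto
  next
    fix K
    assume K: "\<forall>S\<in>K. S \<subseteq> f ` topspace X \<and> openin X {x \<in> topspace X. f x \<in> S}"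
    show "\<Union> K \<subseteq> f ` topspace X" using K by blast
    have "{x \<in> topspace X. f x \<in> \<Union> K} = (\<Union>S\<in>K. {x \<in> topspace X. f x \<in> S})" by blast
    then show "openin X {x \<in> topspace X. f x \<in> \<Union> K}" using K by auto
  qed
  then show ?thesis by (simp add: quotient_topology_def topology_inverse')
qed

definition line_through :: "('b, 'e, 'z) cbundle_scheme \<Rightarrow> 'e \<Rightarrow> 'e set" where
  "line_through E v = range (\<lambda>z. scale E z v)"

definition projectivization :: "('b, 'e, 'z) cbundle_scheme \<Rightarrow> 'e set topology" where
  "projectivization E =
     quotient_topology (subtopology (total E) (nonzero_vectors E)) (line_through E)"

definition projectivization_proj :: "('b, 'e, 'z) cbundle_scheme \<Rightarrow> 'e set \<Rightarrow> 'b" where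
  "projectivization_proj E l = the_elem (bproj E ` l)"

definition tautological_line_bundle :: "('b, 'e, 'z) cbundle_scheme \<Rightarrow> ('e set, 'e set \<times> 'e) cbundle" where
  "tautological_line_bundle E =
     \<lparr>base = projectivization E,
      total = subtopology (prod_topology (projectivization E) (total E)) {(l, v). v \<in> l},
      bproj = fst,
      scale = (\<lambda>z (l, v). (l, scale E z v))\<rparr>"

text \<open>Cocycles \<open>c k\<close> represent the Chern classes of a complex vector bundle \<open>E\<close> of rank \<open>r\<close>. This is
  Grothendieck's definition: on the projectivization, whose dual tautological bundle has first Chern
  class \<open>\<xi>\<close>, the relation \<open>\<Sum>k\<le>r. c\<^sub>k \<xi>\<^sup>r\<^sup>-\<^sup>k = 0\<close> holds. As \<open>1, \<xi>, \<dots>, \<xi>\<^sup>r\<^sup>-\<^sup>1\<close> is a basis of the cohomology of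
  the projectivization over that of the base, it determines the classes.\<close>

definition chern_cocycles :: "('b, 'e, 'z) cbundle_scheme \<Rightarrow> nat \<Rightarrow> (nat \<Rightarrow> ('b, int) cochain) \<Rightarrow> bool" where
  "chern_cocycles E r c \<longleftrightarrow>
     (\<forall>k. c k \<in> cocycles (2 * k) (base E)) \<and>
     c 0 = unit_cochain (base E) \<and>
     (\<forall>k>r. c k \<in> coboundaries (2 * k) (base E)) \<and>
     (\<exists>t. line_bundle_chern_cocycle (tautological_line_bundle E) t \<and>
        (\<lambda>\<sigma>. \<Sum>k\<le>r. cup (2 * k) (2 * (r - k)) (projectivization E)
                 (pullback (2 * k) (projectivization E) (projectivization_proj E) (c k))
                 (cup_list (projectivization E) (replicate (r - k) (2, \<lambda>\<rho>. - t \<rho>))) \<sigma>)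
          \<in> coboundaries (2 * r) (projectivization E))"


section \<open>The fundamental class\<close>

definition determinant :: "nat \<Rightarrow> (nat \<Rightarrow> nat \<Rightarrow> real) \<Rightarrow> real" where
  "determinant m a = (\<Sum>\<pi> | \<pi> permutes {..<m}. of_int (sign \<pi>) * (\<Prod>i<m. a i (\<pi> i)))"

text \<open>A frame \<open>e\<^sub>0, \<dots>, e\<^sub>2\<^sub>n\<^sub>-\<^sub>1\<close> (the rows of \<open>e\<close>) is positive for the linear complex structure \<open>j\<close> if it
  has the orientation of the frames \<open>v\<^sub>0, j v\<^sub>0, \<dots>, v\<^sub>n\<^sub>-\<^sub>1, j v\<^sub>n\<^sub>-\<^sub>1\<close>.\<close>

definition positive_frame :: "nat \<Rightarrow> (nat \<Rightarrow> nat \<Rightarrow> real) \<Rightarrow> (nat \<Rightarrow> nat \<Rightarrow> real) \<Rightarrow> bool" where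
  "positive_frame n j e \<longleftrightarrow>
     (\<exists>v. 0 < determinant (2 * n) e *
        determinant (2 * n) (\<lambda>i. if even i then v (i div 2) else mat_vec (2 * n) j (v (i div 2))))"

text \<open>A cycle represents the fundamental class of a closed almost complex manifold if, relative to the
  complement of any point \<open>p\<close>, it is homologous to any positively oriented affine simplex of a chart
  that has \<open>p\<close> in its interior.\<close>

definition fundamental_cycle ::
    "nat \<Rightarrow> 'a topology \<Rightarrow> 'a chart set \<Rightarrow> 'a endo_field \<Rightarrow> 'a chain \<Rightarrow> bool" where
  "fundamental_cycle n X A J \<mu> \<longleftrightarrow>
     singular_relcycle (2 * n) X {} \<mu> \<and>
     (\<forall>c\<in>A. \<forall>p\<in>fst c. \<forall>w.
        oriented_simplex (2 * n) w ` standard_simplex (2 * n) \<subseteq> chart_image c \<and>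
        (\<exists>x\<in>standard_simplex (2 * n). (\<forall>i\<le>2 * n. 0 < x i) \<and> oriented_simplex (2 * n) w x = snd c p) \<and>
        positive_frame n (J c p) (\<lambda>i k. w (Suc i) k - w 0 k)
        \<longrightarrow> homologous_rel (2 * n) X (topspace X - {p}) \<mu>
              (frag_of (simplex_map (2 * n) (chart_inv c) (oriented_simplex (2 * n) w))))"


section \<open>Polynomials in several variables\<close>

text \<open>The variable \<open>z\<^sub>i\<close> corresponds to the index \<open>i\<close>.\<close>

type_synonym mpoly = "(nat \<Rightarrow>\<^sub>0 nat) \<Rightarrow>\<^sub>0 rat"

definition in_variables :: "nat set \<Rightarrow> mpoly \<Rightarrow> bool" where
  "in_variables I P \<longleftrightarrow> (\<forall>m\<in>Poly_Mapping.keys P. Poly_Mapping.keys m \<subseteq> I)"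

definition monomial_degree :: "(nat \<Rightarrow>\<^sub>0 nat) \<Rightarrow> nat" where
  "monomial_degree m = (\<Sum>i\<in>Poly_Mapping.keys m. Poly_Mapping.lookup m i)"

definition total_degree :: "mpoly \<Rightarrow> nat" where
  "total_degree P = Max (insert 0 (monomial_degree ` Poly_Mapping.keys P))"

definition poly_eval :: "mpoly \<Rightarrow> (nat \<Rightarrow> rat) \<Rightarrow> rat" where
  "poly_eval P x = (\<Sum>m\<in>Poly_Mapping.keys P. Poly_Mapping.lookup P m *
     (\<Prod>i\<in>Poly_Mapping.keys m. x i ^ Poly_Mapping.lookup m i))"

definition poly_substitute :: "mpoly \<Rightarrow> (nat \<Rightarrow> mpoly) \<Rightarrow> mpoly" where
  "poly_substitute P f = (\<Sum>m\<in>Poly_Mapping.keys P. Poly_Mapping.single 0 (Poly_Mapping.lookup P m) *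
     (\<Prod>i\<in>Poly_Mapping.keys m. f i ^ Poly_Mapping.lookup m i))"


section \<open>The Todd class and the index map\<close>

definition elementary_symmetric :: "nat \<Rightarrow> nat \<Rightarrow> mpoly" where
  "elementary_symmetric n k = (\<Sum>S | S \<subseteq> {..<n} \<and> card S = k.
     Poly_Mapping.single (\<Sum>i\<in>S. Poly_Mapping.single i 1) 1)"

definition todd_series :: "rat fps" where
  "todd_series = fps_X / (1 - fps_exp (- 1))"

text \<open>The homogeneous part of degree \<open>k\<close> of \<open>\<Prod>i<n. x\<^sub>i / (1 - exp (- x\<^sub>i))\<close>.\<close>

definition todd_symmetric :: "nat \<Rightarrow> nat \<Rightarrow> mpoly" where
  "todd_symmetric n k = (\<Sum>m | Poly_Mapping.keys m \<subseteq> {..<n} \<and> monomial_degree m = k.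
     Poly_Mapping.single m (\<Prod>i<n. fps_nth todd_series (Poly_Mapping.lookup m i)))"

text \<open>The Todd polynomial \<open>Td\<^sub>k(c\<^sub>1, \<dots>, c\<^sub>n)\<close>; here the variable with index \<open>i\<close> is \<open>c\<^sub>i\<close>.\<close>

definition todd_polynomial :: "nat \<Rightarrow> nat \<Rightarrow> mpoly" where
  "todd_polynomial n k = (THE P. in_variables {1..n} P \<and>
     poly_substitute P (elementary_symmetric n) = todd_symmetric n k)"

text \<open>The component of degree \<open>2k\<close> of the total Todd class. Only monomials of weight \<open>k\<close> occur in
  \<open>todd_polynomial n k\<close>, as \<open>c\<^sub>i\<close> has weight \<open>i\<close>; the sum is restricted to them to have all products in
  degree \<open>2k\<close>.\<close>

definition todd_cocycle ::
    "'a topology \<Rightarrow> nat \<Rightarrow> (nat \<Rightarrow> ('a, int) cochain) \<Rightarrow> nat \<Rightarrow> ('a, rat) cochain" where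
  "todd_cocycle X n c k = (\<lambda>\<sigma>.
     \<Sum>m | Poly_Mapping.keys m \<subseteq> {1..n} \<and> (\<Sum>i=1..n. i * Poly_Mapping.lookup m i) = k.
       Poly_Mapping.lookup (todd_polynomial n k) m *
       cup_list X (concat (map (\<lambda>i. replicate (Poly_Mapping.lookup m i) (2 * i, coeff_rat (c i)))
         [1..<Suc n])) \<sigma>)"

text \<open>The right-hand side of the index formula, \<open>((\<Sum>l. z\<^sup>l / l!) Td)[M]\<close>, for a line bundle with first
  Chern class represented by \<open>z\<close>, where the \<open>c k\<close> represent the Chern classes and \<open>\<mu>\<close> the fundamental
  class. Terms with \<open>l > n\<close> have degree above \<open>2n\<close> and do not contribute.\<close>

definition index_of_cocycle ::
    "'a topology \<Rightarrow> nat \<Rightarrow> (nat \<Rightarrow> ('a, int) cochain) \<Rightarrow> 'a chain \<Rightarrow> ('a, int) cochain \<Rightarrow> rat" where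
  "index_of_cocycle X n c \<mu> z = (\<Sum>l\<le>n.
     evaluate (cup (2 * l) (2 * (n - l)) X
       (cup_list X (replicate l (2, coeff_rat z))) (todd_cocycle X n c (n - l))) \<mu> / fact l)"

text \<open>The index map on \<open>H\<^sup>2(M; \<int>)\<close> and the map it induces modulo torsion. The value does not depend on
  the representatives; it is an integer by the index theorem.\<close>

definition index_H2 ::
    "'a topology \<Rightarrow> nat \<Rightarrow> (nat \<Rightarrow> ('a, int) cochain) \<Rightarrow> 'a chain \<Rightarrow> ('a, int) cochain set \<Rightarrow> rat" where
  "index_H2 X n c \<mu> \<eta> = the_elem (index_of_cocycle X n c \<mu> ` \<eta>)"

definition index_map ::
    "'a topology \<Rightarrow> nat \<Rightarrow> (nat \<Rightarrow> ('a, int) cochain) \<Rightarrow> 'a chain \<Rightarrow> ('a, int) cochain set set \<Rightarrow> rat" where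
  "index_map X n c \<mu> x = the_elem (index_H2 X n c \<mu> ` x)"

text \<open>Primitivity is taken modulo torsion, where \<open>c\<^sub>1 = k \<eta>\<close> is required. For \<open>c\<^sub>1 = 0\<close> there is no
  such \<open>k\<close> and the value is unspecified.\<close>

definition manifold_index :: "'a topology \<Rightarrow> ('a, int) cochain set set \<Rightarrow> int" where
  "manifold_index X c1 = (GREATEST k. \<exists>\<eta>. primitive (H2_mod_torsion X) \<eta> \<and>
     c1 = \<eta> [^]\<^bsub>H2_mod_torsion X\<^esub> k)"

definition hilbert_polynomial :: "'a topology \<Rightarrow> nat \<Rightarrow> (nat \<Rightarrow> ('a, int) cochain) \<Rightarrow> 'a chain \<Rightarrow>
    nat \<Rightarrow> (nat \<Rightarrow> ('a, int) cochain set set) \<Rightarrow> mpoly" where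
  "hilbert_polynomial X n c \<mu> b \<tau> = (THE H. in_variables {..<b} H \<and>
     (\<forall>k::nat \<Rightarrow> int. poly_eval H (\<lambda>i. of_int (k i)) =
        index_map X n c \<mu> (int_combination (H2_mod_torsion X) b \<tau> k)))"

end

theory Submission
  imports Defs
begin

text \<open>The upper bound on the degree comes from the index formula. If cocycles \<open>z\<^sub>i\<close> represent the \<open>\<tau>\<^sub>i\<close>,
  then the value of \<open>(\<Sum>i. k\<^sub>i z\<^sub>i)\<^sup>l\<close> on each singular simplex is a polynomial of degree at most \<open>l\<close> in
  \<open>k\<close>, by the very formula that defines the cup product; so \<open>((\<Sum>l\<le>n. (\<Sum>i. k\<^sub>i z\<^sub>i)\<^sup>l / l!) Td)[M]\<close> is a
  polynomial of degree at most \<open>n\<close> in \<open>k\<close> (\<open>index_of_combination_polynomial\<close>). It is the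
  index of \<open>\<Sum>i. k\<^sub>i \<tau>\<^sub>i\<close> because the value does not depend on the representing cocycle
  (\<open>index_map_class\<close>): by the Leibniz rule cup products of cohomologous cocycles are cohomologous,
  coboundaries vanish on cycles, and a torsion class becomes a coboundary over the rationals.

  The lower bound is an argument with finite differences. A difference of order \<open>e\<^sub>i\<close> in the variable
  \<open>x\<^sub>i\<close>, taken for all \<open>i\<close> at once, annihilates every monomial in which some exponent is below \<open>e\<^sub>i\<close>;
  on polynomials of degree at most \<open>\<Sum>i. e\<^sub>i\<close> it therefore only sees the coefficient of \<open>\<Prod>i. x\<^sub>i ^ e\<^sub>i\<close>
  (\<open>iterated_difference\<close>). This has two uses. Applied to a monomial of maximal degree it shows that
  a polynomial is determined by its values at integer points, so that the generalized Hilbert polynomial \<open>H\<close> is unique. Applied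
  with all \<open>e\<^sub>i = k\<^sub>0 - 1\<close> along the \<open>\<eta>\<^sub>i\<close>, it involves the points \<open>- \<Sum>i. k\<^sub>i \<eta>\<^sub>i\<close> with \<open>1 \<le> k\<^sub>i \<le> k\<^sub>0\<close>. Among
  them \<open>H\<close> is nonzero only where every \<open>k\<^sub>i\<close> equals \<open>k\<^sub>0\<close>, that is, at \<open>- c\<^sub>1\<close>. So the difference is a sign
  times the nonzero index of \<open>- c\<^sub>1\<close>, which forces the degree of \<open>H\<close> to be at least \<open>b\<^sub>2 (k\<^sub>0 - 1)\<close>. For
  \<open>b\<^sub>2 > 0\<close> the index \<open>k\<^sub>0\<close> is the greatest common divisor of the coordinates \<open>N\<^sub>i\<close> of \<open>c\<^sub>1\<close> (\<open>greatest_primitive_multiple\<close>), so it is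
  positive and \<open>k\<^sub>0 \<eta>\<^sub>i = N\<^sub>i \<tau>\<^sub>i\<close>.\<close>

section \<open>Finite differences of polynomials in several variables\<close>

lemma poly_eval_superset:
  assumes "finite S" "Poly_Mapping.keys P \<subseteq> S"
  shows "poly_eval P x = (\<Sum>m\<in>S. Poly_Mapping.lookup P m *
           (\<Prod>i\<in>Poly_Mapping.keys m. x i ^ Poly_Mapping.lookup m i))"
  unfolding poly_eval_def
  by (rule sum.mono_neutral_left) (use assms in \<open>auto simp: in_keys_iff\<close>)

lemma monomial_value_superset:
  fixes x :: "nat \<Rightarrow> rat"
  assumes "finite I" "Poly_Mapping.keys m \<subseteq> I"
  shows "(\<Prod>i\<in>Poly_Mapping.keys m. x i ^ Poly_Mapping.lookup m i) =
         (\<Prod>i\<in>I. x i ^ Poly_Mapping.lookup m i)"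
  by (rule prod.mono_neutral_left) (use assms in \<open>auto simp: in_keys_iff\<close>)

lemma monomial_degree_superset:
  assumes "finite I" "Poly_Mapping.keys m \<subseteq> I"
  shows "monomial_degree m = (\<Sum>i\<in>I. Poly_Mapping.lookup m i)"
  unfolding monomial_degree_def
  by (rule sum.mono_neutral_left) (use assms in \<open>auto simp: in_keys_iff\<close>)

lemma monomial_degree_add: "monomial_degree (m + m') = monomial_degree m + monomial_degree m'"
proof -
  let ?I = "Poly_Mapping.keys m \<union> Poly_Mapping.keys m'"
  have "Poly_Mapping.keys (m + m') \<subseteq> ?I" by (rule keys_add)
  then show ?thesis
    by (simp add: monomial_degree_superset[of ?I] lookup_add sum.distrib)
qed

lemma total_degree_le_iff:
  "total_degree P \<le> d \<longleftrightarrow> (\<forall>m\<in>Poly_Mapping.keys P. monomial_degree m \<le> d)"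
  unfolding total_degree_def by (subst Max_le_iff) auto

lemma poly_eval_add: "poly_eval (P + Q) x = poly_eval P x + poly_eval Q x"
proof -
  let ?S = "Poly_Mapping.keys P \<union> Poly_Mapping.keys Q"
  have "Poly_Mapping.keys (P + Q) \<subseteq> ?S" by (rule keys_add)
  then show ?thesis
    by (simp add: poly_eval_superset[of ?S] lookup_add sum.distrib distrib_right)
qed

lemma poly_eval_diff: "poly_eval (P - Q) x = poly_eval P x - poly_eval Q x"
  using poly_eval_add[of "P - Q" Q x] by simp

lemma poly_eval_0 [simp]: "poly_eval 0 x = 0"
  by (simp add: poly_eval_def)

lemma poly_eval_sum: "poly_eval (\<Sum>a\<in>S. f a) x = (\<Sum>a\<in>S. poly_eval (f a) x)"
  by (induction S rule: infinite_finite_induct) (simp_all add: poly_eval_add)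

lemma poly_eval_single:
  "poly_eval (Poly_Mapping.single m a) x =
     a * (\<Prod>i\<in>Poly_Mapping.keys m. x i ^ Poly_Mapping.lookup m i)"
  by (simp add: poly_eval_superset[of "{m}"])

lemma poly_eval_cong:
  assumes "in_variables I P" "\<And>i. i \<in> I \<Longrightarrow> x i = y i"
  shows "poly_eval P x = poly_eval P y"
  unfolding poly_eval_def using assms
  by (intro sum.cong prod.cong arg_cong2[of _ _ _ _ "(*)"] refl arg_cong2[of _ _ _ _ "(^)"])
     (auto simp: in_variables_def)

text \<open>The sum is, up to the factor \<open>m!\<close>, the coefficient of \<open>X\<^sup>m\<close> in
  \<open>exp (\<alpha> X) (1 - exp (\<beta> X))\<^sup>K\<close>, and \<open>1 - exp (\<beta> X)\<close> is divisible by \<open>X\<close>.\<close>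

lemma alternating_binomial_sum:
  fixes \<alpha> \<beta> :: rat
  shows "(\<Sum>j\<le>K. (- 1) ^ j * of_nat (K choose j) * (\<alpha> + \<beta> * of_nat j) ^ m) =
         (if m < K then 0 else fact m * fps_nth (fps_exp \<alpha> * fps_shift 1 (1 - fps_exp \<beta>) ^ K) (m - K))"
proof -
  define h where "h = fps_shift 1 (1 - fps_exp \<beta>)"
  have h: "1 - fps_exp \<beta> = fps_X * h"
    by (rule fps_ext) (simp add: h_def fps_X_mult_nth)
  have "fps_exp \<alpha> * (1 - fps_exp \<beta>) ^ K =
        fps_exp \<alpha> * (\<Sum>j\<le>K. of_nat (K choose j) * (- fps_exp \<beta>) ^ j)"
    using binomial_ring[of "- fps_exp \<beta>" 1 K] by simp
  also have "\<dots> = (\<Sum>j\<le>K. fps_const ((- 1) ^ j * of_nat (K choose j)) * fps_exp (\<alpha> + \<beta> * of_nat j))"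
    unfolding sum_distrib_left
  proof (rule sum.cong [OF refl])
    fix j
    have "(- fps_exp \<beta>) ^ j = fps_const ((- 1) ^ j) * fps_exp (\<beta> * of_nat j)"
      by (cases "even j") (simp_all add: fps_exp_power_mult mult.commute flip: fps_const_neg)
    then show "fps_exp \<alpha> * (of_nat (K choose j) * (- fps_exp \<beta>) ^ j) =
      fps_const ((- 1) ^ j * of_nat (K choose j)) * fps_exp (\<alpha> + \<beta> * of_nat j)"
      by (simp add: fps_exp_add_mult fps_of_nat[symmetric] mult_ac flip: fps_const_mult)
  qed
  finally have "fps_nth (fps_exp \<alpha> * (1 - fps_exp \<beta>) ^ K) m =
      (\<Sum>j\<le>K. (- 1) ^ j * of_nat (K choose j) * (\<alpha> + \<beta> * of_nat j) ^ m) / fact m"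
    by (simp add: fps_sum_nth sum_divide_distrib)
  moreover have "fps_exp \<alpha> * (1 - fps_exp \<beta>) ^ K = fps_X ^ K * (fps_exp \<alpha> * h ^ K)"
    by (simp add: h power_mult_distrib mult_ac)
  ultimately have "fps_nth (fps_X ^ K * (fps_exp \<alpha> * h ^ K)) m * fact m =
      (\<Sum>j\<le>K. (- 1) ^ j * of_nat (K choose j) * (\<alpha> + \<beta> * of_nat j) ^ m)"
    by simp
  then show ?thesis
    by (auto simp: fps_X_power_mult_nth h_def mult.commute split: if_splits)
qed

lemma alternating_binomial_sum_low:
  fixes \<alpha> \<beta> :: rat
  shows "m < K \<Longrightarrow> (\<Sum>j\<le>K. (- 1) ^ j * of_nat (K choose j) * (\<alpha> + \<beta> * of_nat j) ^ m) = 0"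
  by (simp add: alternating_binomial_sum)

lemma alternating_binomial_sum_top:
  fixes \<alpha> \<beta> :: rat
  shows "(\<Sum>j\<le>K. (- 1) ^ j * of_nat (K choose j) * (\<alpha> + \<beta> * of_nat j) ^ K) = (- \<beta>) ^ K * fact K"
  by (simp add: alternating_binomial_sum fps_nth_power_0)

text \<open>The exponent vector of \<open>\<Prod>i<b. x\<^sub>i ^ e i\<close>.\<close>

definition box_monomial :: "nat \<Rightarrow> (nat \<Rightarrow> nat) \<Rightarrow> nat \<Rightarrow>\<^sub>0 nat" where
  "box_monomial b e = (\<Sum>i<b. Poly_Mapping.single i (e i))"

lemma lookup_box_monomial: "Poly_Mapping.lookup (box_monomial b e) i = (if i < b then e i else 0)"
  by (simp add: box_monomial_def lookup_sum lookup_single when_def if_distrib cong: if_cong)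

text \<open>On a monomial the difference factorises into one alternating sum for each variable. A factor
  is zero as soon as the exponent is below \<open>e i\<close>; if no exponent is, the bound on the degree leaves
  only the monomial with exponents \<open>e\<close>.\<close>

lemma iterated_difference:
  fixes \<alpha> \<beta> :: "nat \<Rightarrow> rat"
  assumes vars: "in_variables {..<b} P" and deg: "total_degree P \<le> (\<Sum>i<b. e i)"
  shows "(\<Sum>k\<in>PiE {..<b} (\<lambda>i. {..e i}). (\<Prod>i<b. (- 1) ^ k i * of_nat (e i choose k i)) *
            poly_eval P (\<lambda>i. \<alpha> i + \<beta> i * of_nat (k i))) =
         Poly_Mapping.lookup P (box_monomial b e) * (\<Prod>i<b. (- \<beta> i) ^ e i * fact (e i))"
    (is "?L = ?R")
proof -
  let ?B = "PiE {..<b} (\<lambda>i. {..e i})"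
  define S where "S = (\<lambda>i d. \<Sum>j\<le>e i. (- 1) ^ j * of_nat (e i choose j) * (\<alpha> i + \<beta> i * of_nat j) ^ d)"
  have keys: "Poly_Mapping.keys m \<subseteq> {..<b}" if "m \<in> Poly_Mapping.keys P" for m
    using vars that by (auto simp: in_variables_def)
  have "?L = (\<Sum>k\<in>?B. \<Sum>m\<in>Poly_Mapping.keys P. Poly_Mapping.lookup P m *
      (\<Prod>i<b. (- 1) ^ k i * of_nat (e i choose k i) * (\<alpha> i + \<beta> i * of_nat (k i)) ^ Poly_Mapping.lookup m i))"
    unfolding poly_eval_def sum_distrib_left
    by (intro sum.cong refl)
       (simp add: monomial_value_superset[OF finite_lessThan keys] prod.distrib mult_ac)
  also have "\<dots> = (\<Sum>m\<in>Poly_Mapping.keys P. Poly_Mapping.lookup P m *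
      (\<Sum>k\<in>?B. \<Prod>i<b. (- 1) ^ k i * of_nat (e i choose k i) * (\<alpha> i + \<beta> i * of_nat (k i)) ^ Poly_Mapping.lookup m i))"
    unfolding sum_distrib_left by (rule sum.swap)
  also have "\<dots> = (\<Sum>m\<in>Poly_Mapping.keys P. Poly_Mapping.lookup P m * (\<Prod>i<b. S i (Poly_Mapping.lookup m i)))"
    unfolding S_def by (subst prod_sum_PiE) auto
  also have "\<dots> = (\<Sum>m\<in>Poly_Mapping.keys P. if m = box_monomial b e then ?R else 0)"
  proof (rule sum.cong [OF refl])
    fix m assume m: "m \<in> Poly_Mapping.keys P"
    show "Poly_Mapping.lookup P m * (\<Prod>i<b. S i (Poly_Mapping.lookup m i)) =
          (if m = box_monomial b e then ?R else 0)"
    proof (cases "\<exists>i<b. Poly_Mapping.lookup m i < e i")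
      case True
      then obtain i where i: "i < b" "Poly_Mapping.lookup m i < e i" by blast
      then have "S i (Poly_Mapping.lookup m i) = 0"
        by (simp add: S_def alternating_binomial_sum_low)
      then have "(\<Prod>i<b. S i (Poly_Mapping.lookup m i)) = 0"
        using i by (intro prod_zero) auto
      moreover have "m \<noteq> box_monomial b e" using i by (auto simp: lookup_box_monomial)
      ultimately show ?thesis by simp
    next
      case False
      have "(\<Sum>i<b. Poly_Mapping.lookup m i) \<le> (\<Sum>i<b. e i)"
        using deg m unfolding total_degree_le_iff
        by (metis monomial_degree_superset[OF finite_lessThan keys[OF m]])
      moreover have ge: "e i \<le> Poly_Mapping.lookup m i" if "i < b" for i
        using False that by (meson not_le)
      ultimately have sums: "(\<Sum>i<b. e i) = (\<Sum>i<b. Poly_Mapping.lookup m i)"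
        using ge by (intro antisym) (auto intro: sum_mono)
      have eq: "Poly_Mapping.lookup m i = e i" if "i < b" for i
        by (rule sum_mono_inv[OF sums, symmetric]) (use ge that in auto)
      have "m = box_monomial b e"
      proof (rule poly_mapping_eqI)
        fix i
        show "Poly_Mapping.lookup m i = Poly_Mapping.lookup (box_monomial b e) i"
          using eq[of i] keys[OF m] unfolding lookup_box_monomial
          by (cases "i < b") (auto simp: in_keys_iff subset_eq)
      qed
      moreover have "(\<Prod>i<b. S i (Poly_Mapping.lookup m i)) = (\<Prod>i<b. (- \<beta> i) ^ e i * fact (e i))"
        by (rule prod.cong[OF refl]) (simp only: S_def eq lessThan_iff alternating_binomial_sum_top)
      ultimately show ?thesis by simp
    qed
  qed
  also have "\<dots> = ?R"
    by (simp add: sum.delta in_keys_iff)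
  finally show ?thesis .
qed

text \<open>A monomial of maximal degree is the only one that survives the iterated difference whose
  orders are its exponents.\<close>

lemma integer_point_identity:
  assumes vars: "in_variables {..<b} P"
    and zero: "\<And>k :: nat \<Rightarrow> int. poly_eval P (\<lambda>i. of_int (k i)) = 0"
  shows "P = 0"
proof (rule ccontr)
  assume "P \<noteq> 0"
  then have ne: "Poly_Mapping.keys P \<noteq> {}" by simp
  obtain m where m: "m \<in> Poly_Mapping.keys P" "\<And>m'. m' \<in> Poly_Mapping.keys P \<Longrightarrow> monomial_degree m' \<le> monomial_degree m"
  proof -
    have "Max (monomial_degree ` Poly_Mapping.keys P) \<in> monomial_degree ` Poly_Mapping.keys P"
      using ne by (intro Max_in) auto
    then obtain m where "m \<in> Poly_Mapping.keys P" "monomial_degree m = Max (monomial_degree ` Poly_Mapping.keys P)"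
      by force
    then show ?thesis by (intro that[of m]) auto
  qed
  let ?e = "Poly_Mapping.lookup m"
  have km: "Poly_Mapping.keys m \<subseteq> {..<b}" using vars m(1) by (auto simp: in_variables_def)
  have "total_degree P \<le> (\<Sum>i<b. ?e i)"
    using m by (simp add: total_degree_le_iff flip: monomial_degree_superset[OF finite_lessThan km])
  from iterated_difference[OF vars this, of "\<lambda>_. 0" "\<lambda>_. 1"]
  have "Poly_Mapping.lookup P (box_monomial b ?e) * (\<Prod>i<b. (- 1) ^ ?e i * fact (?e i)) =
      (\<Sum>k\<in>PiE {..<b} (\<lambda>i. {..?e i}). (\<Prod>i<b. (- 1) ^ k i * of_nat (?e i choose k i)) *
            poly_eval P (\<lambda>i. of_nat (k i)))"
    by simp
  also have "\<dots> = 0"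
    using zero[of "\<lambda>i. int (k i)" for k] by simp
  finally have "Poly_Mapping.lookup P (box_monomial b ?e) = 0" by simp
  moreover have "box_monomial b ?e = m"
    using km by (intro poly_mapping_eqI) (auto simp: lookup_box_monomial in_keys_iff subset_eq)
  ultimately show False using m(1) by (simp add: in_keys_iff)
qed

text \<open>A polynomial of smaller degree has no monomial with exponents \<open>e\<close>, so its iterated
  difference vanishes; but the corner \<open>e\<close> of the box contributes the only nonzero term to it.\<close>

lemma degree_from_box_vanishing:
  fixes \<alpha> \<beta> :: "nat \<Rightarrow> rat"
  assumes vars: "in_variables {..<b} P"
    and zero: "\<And>k. (\<And>i. i < b \<Longrightarrow> k i \<le> e i) \<Longrightarrow> (\<exists>i<b. k i < e i) \<Longrightarrow>
      poly_eval P (\<lambda>i. \<alpha> i + \<beta> i * of_nat (k i)) = 0"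
    and nonzero: "poly_eval P (\<lambda>i. \<alpha> i + \<beta> i * of_nat (e i)) \<noteq> 0"
  shows "(\<Sum>i<b. e i) \<le> total_degree P"
proof (rule ccontr)
  let ?B = "PiE {..<b} (\<lambda>i. {..e i})" and ?e = "restrict e {..<b}"
  assume "\<not> (\<Sum>i<b. e i) \<le> total_degree P"
  then have deg: "total_degree P < (\<Sum>i<b. e i)" by simp
  have "Poly_Mapping.keys (box_monomial b e) \<subseteq> {..<b}"
    by (auto simp: in_keys_iff lookup_box_monomial split: if_splits)
  then have "monomial_degree (box_monomial b e) = (\<Sum>i<b. e i)"
    by (simp add: monomial_degree_superset[OF finite_lessThan] lookup_box_monomial)
  with deg have "box_monomial b e \<notin> Poly_Mapping.keys P"
    using total_degree_le_iff[of P "total_degree P"] by force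
  then have "(\<Sum>k\<in>?B. (\<Prod>i<b. (- 1) ^ k i * of_nat (e i choose k i)) *
      poly_eval P (\<lambda>i. \<alpha> i + \<beta> i * of_nat (k i))) = 0"
    using iterated_difference[OF vars order_less_imp_le[OF deg], of \<alpha> \<beta>] by (simp add: in_keys_iff)
  also have "(\<Sum>k\<in>?B. (\<Prod>i<b. (- 1) ^ k i * of_nat (e i choose k i)) *
      poly_eval P (\<lambda>i. \<alpha> i + \<beta> i * of_nat (k i))) =
    (\<Sum>k\<in>{?e}. (\<Prod>i<b. (- 1) ^ k i * of_nat (e i choose k i)) *
      poly_eval P (\<lambda>i. \<alpha> i + \<beta> i * of_nat (k i)))"
  proof (rule sum.mono_neutral_right)
    show "finite ?B" by (intro finite_PiE) auto
    show "{?e} \<subseteq> ?B" by auto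
    show "\<forall>k\<in>?B - {?e}. (\<Prod>i<b. (- 1) ^ k i * of_nat (e i choose k i)) *
        poly_eval P (\<lambda>i. \<alpha> i + \<beta> i * of_nat (k i)) = 0"
    proof
      fix k assume k: "k \<in> ?B - {?e}"
      then have le: "k i \<le> e i" if "i < b" for i using that by auto
      have "\<exists>i<b. k i < e i"
      proof (rule ccontr)
        assume "\<not> (\<exists>i<b. k i < e i)"
        with le have "k i = e i" if "i < b" for i
          using that by (meson order_antisym not_le)
        moreover have "k \<in> extensional {..<b}" using k by (auto simp: PiE_def)
        ultimately have "k = ?e" by (intro extensionalityI[of k "{..<b}" ?e]) auto
        with k show False by simp
      qed
      with zero[of k] le show "(\<Prod>i<b. (- 1) ^ k i * of_nat (e i choose k i)) *
        poly_eval P (\<lambda>i. \<alpha> i + \<beta> i * of_nat (k i)) = 0" by simp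
    qed
  qed
  also have "\<dots> = (\<Prod>i<b. (- 1) ^ e i) * poly_eval P (\<lambda>i. \<alpha> i + \<beta> i * of_nat (e i))"
    using poly_eval_cong[OF vars, of "\<lambda>i. \<alpha> i + \<beta> i * of_nat (?e i)" "\<lambda>i. \<alpha> i + \<beta> i * of_nat (e i)"]
    by simp
  finally show False using nonzero by simp
qed

section \<open>Polynomial functions on integer points\<close>

text \<open>The degree bound is on a polynomial that induces the function, so that it carries over to
  the generalized Hilbert polynomial.\<close>

definition integer_polynomial :: "nat \<Rightarrow> nat \<Rightarrow> ((nat \<Rightarrow> int) \<Rightarrow> rat) \<Rightarrow> bool" where
  "integer_polynomial b d f \<longleftrightarrow> (\<exists>P. in_variables {..<b} P \<and> total_degree P \<le> d \<and>
     (\<forall>k. f k = poly_eval P (\<lambda>i. of_int (k i))))"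

lemma integer_polynomial_mono: "integer_polynomial b d f \<Longrightarrow> d \<le> d' \<Longrightarrow> integer_polynomial b d' f"
  unfolding integer_polynomial_def by (meson order_trans)

lemma integer_polynomial_const: "integer_polynomial b d (\<lambda>_. a)"
  unfolding integer_polynomial_def
  by (rule exI[of _ "Poly_Mapping.single 0 a"])
     (auto simp: in_variables_def total_degree_le_iff poly_eval_single monomial_degree_def split: if_splits)

lemma integer_polynomial_add:
  assumes "integer_polynomial b d f" "integer_polynomial b d g"
  shows "integer_polynomial b d (\<lambda>k. f k + g k)"
proof -
  from assms obtain P Q where PQ: "in_variables {..<b} P" "total_degree P \<le> d" "\<And>k. f k = poly_eval P (\<lambda>i. of_int (k i))"
    "in_variables {..<b} Q" "total_degree Q \<le> d" "\<And>k. g k = poly_eval Q (\<lambda>i. of_int (k i))"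
    unfolding integer_polynomial_def by blast
  have "Poly_Mapping.keys (P + Q) \<subseteq> Poly_Mapping.keys P \<union> Poly_Mapping.keys Q" by (rule keys_add)
  then have "in_variables {..<b} (P + Q)" "total_degree (P + Q) \<le> d"
    using PQ unfolding in_variables_def total_degree_le_iff by blast+
  with PQ(3,6) show ?thesis unfolding integer_polynomial_def
    by (intro exI[of _ "P + Q"]) (simp add: poly_eval_add)
qed

lemma integer_polynomial_sum:
  assumes "\<And>a. a \<in> S \<Longrightarrow> integer_polynomial b d (f a)"
  shows "integer_polynomial b d (\<lambda>k. \<Sum>a\<in>S. f a k)"
  using assms
  by (induction S rule: infinite_finite_induct)
     (auto intro: integer_polynomial_add integer_polynomial_const)

lemma integer_polynomial_monomial_mult:
  assumes "integer_polynomial b d f" "Poly_Mapping.keys u \<subseteq> {..<b}" "d + monomial_degree u \<le> d'"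
  shows "integer_polynomial b d' (\<lambda>k. a * (\<Prod>i<b. of_int (k i) ^ Poly_Mapping.lookup u i) * f k)"
proof -
  from assms obtain P where P: "in_variables {..<b} P" "total_degree P \<le> d" "\<And>k. f k = poly_eval P (\<lambda>i. of_int (k i))"
    unfolding integer_polynomial_def by blast
  define Q where "Q = (\<Sum>m\<in>Poly_Mapping.keys P. Poly_Mapping.single (u + m) (a * Poly_Mapping.lookup P m))"
  have kQ: "\<exists>m\<in>Poly_Mapping.keys P. m' = u + m" if "m' \<in> Poly_Mapping.keys Q" for m'
  proof -
    have "Poly_Mapping.keys Q \<subseteq> (\<Union>m\<in>Poly_Mapping.keys P. Poly_Mapping.keys (Poly_Mapping.single (u + m) (a * Poly_Mapping.lookup P m)))"
      unfolding Q_def by (rule keys_sum)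
    then show ?thesis using that by (auto split: if_splits)
  qed
  have ku: "Poly_Mapping.keys (u + m) \<subseteq> {..<b}" if "m \<in> Poly_Mapping.keys P" for m
    using P(1) that assms(2) keys_add[of u m] by (force simp: in_variables_def)
  have "in_variables {..<b} Q" using kQ ku unfolding in_variables_def by blast
  moreover have "total_degree Q \<le> d'"
    using kQ P(2) assms(3) by (fastforce simp: total_degree_le_iff monomial_degree_add)
  moreover have "a * (\<Prod>i<b. of_int (k i) ^ Poly_Mapping.lookup u i) * f k = poly_eval Q (\<lambda>i. of_int (k i))" for k
  proof -
    have "poly_eval Q (\<lambda>i. of_int (k i)) = (\<Sum>m\<in>Poly_Mapping.keys P. a * Poly_Mapping.lookup P m *
      (\<Prod>i<b. of_int (k i) ^ Poly_Mapping.lookup (u + m) i))"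
      unfolding Q_def poly_eval_sum poly_eval_single
      by (intro sum.cong refl) (simp add: monomial_value_superset[OF finite_lessThan ku])
    also have "\<dots> = (\<Sum>m\<in>Poly_Mapping.keys P. a * (\<Prod>i<b. of_int (k i) ^ Poly_Mapping.lookup u i) * (Poly_Mapping.lookup P m *
      (\<Prod>i\<in>Poly_Mapping.keys m. of_int (k i) ^ Poly_Mapping.lookup m i)))"
      using P(1) unfolding in_variables_def
      by (intro sum.cong refl)
         (simp add: monomial_value_superset[of "{..<b}"] lookup_add power_add prod.distrib mult_ac)
    finally show ?thesis by (simp add: P(3) poly_eval_def sum_distrib_left)
  qed
  ultimately show ?thesis unfolding integer_polynomial_def by blast
qed

lemma integer_polynomial_cmult:
  assumes "integer_polynomial b d f"
  shows "integer_polynomial b d (\<lambda>k. a * f k)"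
  using integer_polynomial_monomial_mult[OF assms, of 0 d a] by (simp add: monomial_degree_def)

lemma integer_polynomial_coordinate_mult:
  assumes "integer_polynomial b d f" "i < b"
  shows "integer_polynomial b (Suc d) (\<lambda>k. of_int (k i) * f k)"
proof -
  have "(\<Prod>j<b. of_int (k j) ^ Poly_Mapping.lookup (Poly_Mapping.single i 1) j) = (of_int (k i) :: rat)" for k
    using assms(2) by (subst prod.remove[of _ i]) (auto simp: lookup_single when_def intro!: prod.neutral)
  with integer_polynomial_monomial_mult[OF assms(1), of "Poly_Mapping.single i 1" "Suc d" 1] assms(2)
  show ?thesis by (simp add: monomial_degree_def)
qed

section \<open>The cup product on cohomology\<close>

lemma coboundary_add:
  "coboundary p X (\<lambda>\<sigma>. \<phi> \<sigma> + \<psi> \<sigma>) = (\<lambda>\<sigma>. coboundary p X \<phi> \<sigma> + coboundary p X \<psi> \<sigma>)"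
  by (rule ext) (simp add: coboundary_def distrib_left sum.distrib)

lemma coboundary_cmult:
  "coboundary p X (\<lambda>\<sigma>. a * \<phi> \<sigma>) = (\<lambda>\<sigma>. a * coboundary p X \<phi> \<sigma>)"
  by (rule ext) (simp add: coboundary_def sum_distrib_left mult.left_commute del: sum.atMost_Suc)

lemma coboundary_zero [simp]: "coboundary p X (\<lambda>\<sigma>. 0) = (\<lambda>\<sigma>. 0)"
  by (rule ext) (simp add: coboundary_def)

lemma zero_in_cochains [simp]: "(\<lambda>\<sigma>. 0) \<in> cochains p X"
  by (simp add: cochains_def)

lemma cochains_add: "\<phi> \<in> cochains p X \<Longrightarrow> \<psi> \<in> cochains p X \<Longrightarrow> (\<lambda>\<sigma>. \<phi> \<sigma> + \<psi> \<sigma>) \<in> cochains p X"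
  by (simp add: cochains_def)

lemma cochains_cmult: "\<phi> \<in> cochains p X \<Longrightarrow> (\<lambda>\<sigma>. a * \<phi> \<sigma>) \<in> cochains p X"
  by (simp add: cochains_def)

lemma coboundary_in_cochains: "coboundary p X \<phi> \<in> cochains (Suc p) X"
  by (simp add: cochains_def coboundary_def)

lemma cup_in_cochains: "cup p q X \<phi> \<psi> \<in> cochains (p + q) X"
  by (simp add: cochains_def cup_def)

lemma cocycles_add: "\<phi> \<in> cocycles p X \<Longrightarrow> \<psi> \<in> cocycles p X \<Longrightarrow> (\<lambda>\<sigma>. \<phi> \<sigma> + \<psi> \<sigma>) \<in> cocycles p X"
  by (simp add: cocycles_def cochains_add coboundary_add)

lemma cocycles_cmult: "\<phi> \<in> cocycles p X \<Longrightarrow> (\<lambda>\<sigma>. a * \<phi> \<sigma>) \<in> cocycles p X"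
  by (simp add: cocycles_def cochains_cmult coboundary_cmult)

lemma zero_in_cocycles [simp]: "(\<lambda>\<sigma>. 0) \<in> cocycles p X"
  by (simp add: cocycles_def)

lemma cocycles_sum:
  assumes "\<And>a. a \<in> S \<Longrightarrow> f a \<in> cocycles p X"
  shows "(\<lambda>\<sigma>. \<Sum>a\<in>S. f a \<sigma>) \<in> cocycles p X"
  using assms by (induction S rule: infinite_finite_induct) (auto intro: cocycles_add)

lemma cocycle_coboundary: "\<phi> \<in> cocycles p X \<Longrightarrow> coboundary p X \<phi> = (\<lambda>\<sigma>. 0)"
  by (auto simp: cocycles_def)

lemma coboundaries_Suc: "coboundaries (Suc p) X = coboundary p X ` cochains p X"
  by (simp add: coboundaries_def)

lemma coboundaries_add:
  "\<phi> \<in> coboundaries p X \<Longrightarrow> \<psi> \<in> coboundaries p X \<Longrightarrow> (\<lambda>\<sigma>. \<phi> \<sigma> + \<psi> \<sigma>) \<in> coboundaries p X"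
  unfolding coboundaries_def
  by (auto simp flip: coboundary_add split: if_splits) (blast intro: cochains_add)+

lemma coboundaries_cmult:
  "\<phi> \<in> coboundaries p X \<Longrightarrow> (\<lambda>\<sigma>. a * \<phi> \<sigma>) \<in> coboundaries p X"
  unfolding coboundaries_def
  by (auto simp flip: coboundary_cmult split: if_splits) (blast intro: cochains_cmult)+

lemma zero_in_coboundaries [simp]: "(\<lambda>\<sigma>. 0) \<in> coboundaries p X"
  by (auto simp: coboundaries_def intro!: image_eqI[of _ _ "\<lambda>\<sigma>. 0"])

lemma evaluate_superset:
  assumes "finite S" "Poly_Mapping.keys \<mu> \<subseteq> S"
  shows "evaluate \<phi> \<mu> = (\<Sum>\<sigma>\<in>S. of_int (Poly_Mapping.lookup \<mu> \<sigma>) * \<phi> \<sigma>)"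
  unfolding evaluate_def
  by (rule sum.mono_neutral_left) (use assms in \<open>auto simp: in_keys_iff\<close>)

lemma evaluate_chain_add: "evaluate \<phi> (\<mu> + \<nu>) = evaluate \<phi> \<mu> + evaluate \<phi> \<nu>"
proof -
  let ?S = "Poly_Mapping.keys \<mu> \<union> Poly_Mapping.keys \<nu>"
  have "Poly_Mapping.keys (\<mu> + \<nu>) \<subseteq> ?S" by (rule keys_add)
  then show ?thesis
    by (simp add: evaluate_superset[of ?S] lookup_add sum.distrib distrib_right)
qed

lemma evaluate_chain_zero [simp]: "evaluate \<phi> 0 = 0"
  by (simp add: evaluate_def)

lemma evaluate_chain_sum: "evaluate \<phi> (\<Sum>a\<in>S. f a) = (\<Sum>a\<in>S. evaluate \<phi> (f a))"
  by (induction S rule: infinite_finite_induct) (simp_all add: evaluate_chain_add)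

lemma evaluate_chain_cmul: "evaluate \<phi> (frag_cmul a \<mu>) = of_int a * evaluate \<phi> \<mu>"
  by (subst evaluate_superset[OF finite_keys keys_cmul])
     (simp add: evaluate_def sum_distrib_left mult.assoc)

lemma evaluate_frag_of [simp]: "evaluate \<phi> (frag_of \<sigma>) = \<phi> \<sigma>"
  by (simp add: evaluate_def)

text \<open>The coboundary is dual to the boundary of singular chains. This turns \<open>\<partial>\<partial> = 0\<close> into the
  facts that coboundaries vanish on cycles and are cocycles.\<close>

lemma evaluate_coboundary:
  assumes "singular_chain (Suc p) X \<mu>"
  shows "evaluate (coboundary p X \<phi>) \<mu> = evaluate \<phi> (chain_boundary (Suc p) \<mu>)"
proof -
  have "evaluate \<phi> (chain_boundary (Suc p) \<mu>) =
    (\<Sum>\<sigma>\<in>Poly_Mapping.keys \<mu>. of_int (Poly_Mapping.lookup \<mu> \<sigma>) *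
        (\<Sum>k\<le>Suc p. (- 1) ^ k * \<phi> (singular_face (Suc p) k \<sigma>)))"
    by (simp add: chain_boundary_def frag_extend_def evaluate_chain_sum evaluate_chain_cmul
        evaluate_chain_add del: sum.atMost_Suc)
  also have "\<dots> = evaluate (coboundary p X \<phi>) \<mu>"
    unfolding evaluate_def coboundary_def using assms
    by (intro sum.cong refl) (auto simp: singular_chain_def simp del: sum.atMost_Suc)
  finally show ?thesis ..
qed

lemma evaluate_coboundaries:
  assumes "\<phi> \<in> coboundaries p X" "singular_relcycle p X {} \<mu>"
  shows "evaluate \<phi> \<mu> = 0"
proof (cases p)
  case 0
  then show ?thesis using assms by (simp add: coboundaries_def evaluate_def)
next
  case (Suc q)
  then show ?thesis using assms
    by (auto simp: coboundaries_Suc singular_cycle evaluate_coboundary)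
qed

lemma coboundaries_subset_cocycles: "coboundaries p X \<subseteq> cocycles p X"
proof (cases p)
  case 0
  then show ?thesis by (simp add: coboundaries_def)
next
  case (Suc q)
  have "coboundary (Suc q) X (coboundary q X \<phi>) \<sigma> = 0" for \<phi> :: "('a, 'b) cochain" and \<sigma>
  proof (cases "singular_simplex (Suc (Suc q)) X \<sigma>")
    case True
    then have ch: "singular_chain (Suc (Suc q)) X (frag_of \<sigma>)" by (simp add: singular_chain_of)
    have "coboundary (Suc q) X (coboundary q X \<phi>) \<sigma> =
          evaluate (coboundary (Suc q) X (coboundary q X \<phi>)) (frag_of \<sigma>)"
      by simp
    also have "\<dots> = evaluate \<phi> (chain_boundary (Suc q) (chain_boundary (Suc (Suc q)) (frag_of \<sigma>)))"
      using singular_chain_boundary[OF ch] by (simp only: evaluate_coboundary ch evaluate_coboundary diff_Suc_Suc diff_zero)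
    also have "\<dots> = 0" using chain_boundary_boundary[OF ch] by simp
    finally show ?thesis .
  qed (simp add: coboundary_def)
  with Suc show ?thesis
    by (auto simp: coboundaries_Suc cocycles_def coboundary_in_cochains)
qed

lemma singular_simplex_front_face:
  assumes "singular_simplex (p + q) X \<sigma>"
  shows "singular_simplex p X (front_face p \<sigma>)"
  using assms standard_simplex_mono[of p "p + q"]
  by (auto simp: singular_simplex_def front_face_def
      intro: continuous_map_from_subtopology_mono)

text \<open>The inclusion of the standard simplex as the face opposite to the first \<open>p\<close> vertices; the
  back face of a singular simplex is its composition with this map.\<close>

definition back_inclusion :: "nat \<Rightarrow> (nat \<Rightarrow> real) \<Rightarrow> nat \<Rightarrow> real" where
  "back_inclusion p x = (\<lambda>i. if i < p then 0 else x (i - p))"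

lemma back_inclusion_in_standard_simplex:
  assumes "x \<in> standard_simplex q"
  shows "back_inclusion p x \<in> standard_simplex (p + q)"
proof -
  have "(\<Sum>i\<le>p + q. back_inclusion p x i) = (\<Sum>i\<in>{p..p + q}. back_inclusion p x i)"
    by (rule sum.mono_neutral_right) (auto simp: back_inclusion_def)
  also have "\<dots> = (\<Sum>i\<in>{0..q}. x i)"
    using sum.shift_bounds_cl_nat_ivl[of "back_inclusion p x" 0 p q] by (simp add: back_inclusion_def add.commute)
  also have "\<dots> = 1" using assms by (simp add: standard_simplex_def atMost_atLeast0)
  finally show ?thesis using assms by (auto simp: standard_simplex_def back_inclusion_def)
qed

lemma back_face_alt: "back_face p q \<sigma> = restrict (\<sigma> \<circ> back_inclusion p) (standard_simplex q)"
  by (auto simp: back_face_def back_inclusion_def fun_eq_iff)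

lemma singular_simplex_back_face:
  assumes "singular_simplex (p + q) X \<sigma>"
  shows "singular_simplex q X (back_face p q \<sigma>)"
proof -
  let ?PT = "powertop_real UNIV"
  have "continuous_map (subtopology ?PT (standard_simplex q)) (subtopology ?PT (standard_simplex (p + q))) (back_inclusion p)"
  proof (clarsimp simp add: continuous_map_in_subtopology back_inclusion_in_standard_simplex continuous_map_componentwise image_subset_iff Pi_iff)
    fix i
    have "continuous_map ?PT euclideanreal (\<lambda>x. if i < p then 0 else x (i - p))"
      by (auto intro: continuous_map_product_projection)
    then show "continuous_map (subtopology ?PT (standard_simplex q)) euclideanreal (\<lambda>x. back_inclusion p x i)"
      by (simp add: back_inclusion_def continuous_map_from_subtopology)
  qed
  moreover have "continuous_map (subtopology ?PT (standard_simplex (p + q))) X \<sigma>"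
    using assms by (simp add: singular_simplex_def)
  ultimately have "continuous_map (subtopology ?PT (standard_simplex q)) X (\<sigma> \<circ> back_inclusion p)"
    by (rule continuous_map_compose)
  then show ?thesis by (simp add: singular_simplex_def back_face_alt)
qed

text \<open>Deleting a vertex of a simplex affects either its front or its back part. These four
  identities are what the Leibniz rule needs.\<close>

lemma front_face_face_low:
  assumes "k \<le> Suc p"
  shows "front_face p (singular_face (Suc (p + q)) k \<sigma>) = singular_face (Suc p) k (front_face (Suc p) \<sigma>)"
proof
  fix x
  show "front_face p (singular_face (Suc (p + q)) k \<sigma>) x = singular_face (Suc p) k (front_face (Suc p) \<sigma>) x"
    using standard_simplex_mono[of p "p + q"] simplical_face_in_standard_simplex[of "Suc p" k x] assms
    by (auto simp: front_face_def singular_face_def restrict_def)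
qed

lemma front_face_face_high:
  assumes "p < k"
  shows "front_face p (singular_face (Suc (p + q)) k \<sigma>) = front_face p \<sigma>"
proof
  fix x
  have "simplical_face k x = x" if "x \<in> standard_simplex p"
    using that assms by (auto simp: simplical_face_def standard_simplex_def fun_eq_iff)
  then show "front_face p (singular_face (Suc (p + q)) k \<sigma>) x = front_face p \<sigma> x"
    using standard_simplex_mono[of p "p + q"] 
    by (auto simp: front_face_def singular_face_def restrict_def)
qed

lemma back_face_face_low:
  assumes "k \<le> p"
  shows "back_face p q (singular_face (Suc (p + q)) k \<sigma>) = back_face (Suc p) q \<sigma>"
proof
  fix x
  have "simplical_face k (back_inclusion p x) = back_inclusion (Suc p) x"
    using assms by (auto simp: simplical_face_def back_inclusion_def fun_eq_iff)
  then show "back_face p q (singular_face (Suc (p + q)) k \<sigma>) x = back_face (Suc p) q \<sigma> x"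
    using back_inclusion_in_standard_simplex[of x q p]
    by (auto simp: back_face_alt singular_face_def restrict_def)
qed

lemma back_face_face_high:
  assumes "k \<le> Suc q"
  shows "back_face p q (singular_face (Suc (p + q)) (p + k) \<sigma>) = singular_face (Suc q) k (back_face p (Suc q) \<sigma>)"
proof
  fix x
  have "simplical_face (p + k) (back_inclusion p x) = back_inclusion p (simplical_face k x)"
    by (auto simp: simplical_face_def back_inclusion_def fun_eq_iff)
  then show "back_face p q (singular_face (Suc (p + q)) (p + k) \<sigma>) x = singular_face (Suc q) k (back_face p (Suc q) \<sigma>) x"
    using back_inclusion_in_standard_simplex[of x q p] simplical_face_in_standard_simplex[of "Suc q" k x] assms
    by (auto simp: back_face_alt singular_face_def restrict_def)
qed

text \<open>The Leibniz rule. The faces with index at most \<open>p\<close> affect only the front, the others only the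
  back. On the right-hand side there are two more terms, the last face of the front \<open>(p + 1)\<close>-simplex
  and the first face of the back \<open>(q + 1)\<close>-simplex; they cancel.\<close>

lemma coboundary_cup:
  fixes \<phi> \<psi> :: "('a, 'r::comm_ring_1) cochain"
  shows "coboundary (p + q) X (cup p q X \<phi> \<psi>) \<sigma> =
     cup (Suc p) q X (coboundary p X \<phi>) \<psi> \<sigma> + (- 1) ^ p * cup p (Suc q) X \<phi> (coboundary q X \<psi>) \<sigma>"
proof (cases "singular_simplex (Suc (p + q)) X \<sigma>")
  case True
  let ?f = "\<lambda>k. \<phi> (singular_face (Suc p) k (front_face (Suc p) \<sigma>))"
  let ?g = "\<lambda>k. \<psi> (singular_face (Suc q) k (back_face p (Suc q) \<sigma>))"
  let ?F = "\<phi> (front_face p \<sigma>)" and ?G = "\<psi> (back_face (Suc p) q \<sigma>)"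
  have sf: "singular_simplex (Suc p) X (front_face (Suc p) \<sigma>)"
    using singular_simplex_front_face[of "Suc p" q X \<sigma>] True by simp
  have sb: "singular_simplex (Suc q) X (back_face p (Suc q) \<sigma>)"
    using singular_simplex_back_face[of p "Suc q" X \<sigma>] True by simp
  have face: "cup p q X \<phi> \<psi> (singular_face (Suc (p + q)) k \<sigma>) =
      \<phi> (front_face p (singular_face (Suc (p + q)) k \<sigma>)) * \<psi> (back_face p q (singular_face (Suc (p + q)) k \<sigma>))"
    if "k \<le> Suc (p + q)" for k
    using singular_simplex_singular_face[OF True _ that] by (simp add: cup_def)
  have "coboundary (p + q) X (cup p q X \<phi> \<psi>) \<sigma> =
      (\<Sum>k\<le>Suc (p + q). (- 1) ^ k * cup p q X \<phi> \<psi> (singular_face (Suc (p + q)) k \<sigma>))"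
    using True by (simp add: coboundary_def)
  also have "{..Suc (p + q)} = {..p} \<union> {Suc p..Suc (p + q)}" by auto
  also have "(\<Sum>k\<in>{..p} \<union> {Suc p..Suc (p + q)}. (- 1) ^ k * cup p q X \<phi> \<psi> (singular_face (Suc (p + q)) k \<sigma>)) =
      (\<Sum>k\<le>p. (- 1) ^ k * cup p q X \<phi> \<psi> (singular_face (Suc (p + q)) k \<sigma>)) +
      (\<Sum>k=Suc p..Suc (p + q). (- 1) ^ k * cup p q X \<phi> \<psi> (singular_face (Suc (p + q)) k \<sigma>))"
    by (rule sum.union_disjoint) auto
  also have "(\<Sum>k\<le>p. (- 1) ^ k * cup p q X \<phi> \<psi> (singular_face (Suc (p + q)) k \<sigma>)) =
      (\<Sum>k\<le>p. (- 1) ^ k * ?f k * ?G)"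
    by (intro sum.cong refl) (simp add: face front_face_face_low back_face_face_low mult_ac)
  also have "(\<Sum>k=Suc p..Suc (p + q). (- 1) ^ k * cup p q X \<phi> \<psi> (singular_face (Suc (p + q)) k \<sigma>)) =
      (\<Sum>k=1..Suc q. (- 1) ^ (p + k) * (?F * ?g k))"
  proof -
    have "(\<Sum>k=Suc p..Suc (p + q). (- 1) ^ k * cup p q X \<phi> \<psi> (singular_face (Suc (p + q)) k \<sigma>)) =
      (\<Sum>k=1..Suc q. (- 1) ^ (k + p) * cup p q X \<phi> \<psi> (singular_face (Suc (p + q)) (k + p) \<sigma>))"
      using sum.shift_bounds_cl_nat_ivl[of "\<lambda>k. (- 1) ^ k * cup p q X \<phi> \<psi> (singular_face (Suc (p + q)) k \<sigma>)" 1 p "Suc q"]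
      by (simp add: add.commute)
    also have "\<dots> = (\<Sum>k=1..Suc q. (- 1) ^ (p + k) * (?F * ?g k))"
    proof (rule sum.cong[OF refl])
      fix k assume "k \<in> {1..Suc q}"
      then have k: "p < p + k" "k \<le> Suc q" "p + k \<le> Suc (p + q)" by auto
      show "(- 1) ^ (k + p) * cup p q X \<phi> \<psi> (singular_face (Suc (p + q)) (k + p) \<sigma>) =
            (- 1) ^ (p + k) * (?F * ?g k)"
        unfolding add.commute[of k p] face[OF k(3)] front_face_face_high[OF k(1)] back_face_face_high[OF k(2)] ..
    qed
    finally show ?thesis .
  qed
  also have "(\<Sum>k\<le>p. (- 1) ^ k * ?f k * ?G) + (\<Sum>k=1..Suc q. (- 1) ^ (p + k) * (?F * ?g k)) =
      (\<Sum>k\<le>Suc p. (- 1) ^ k * ?f k) * ?G + (- 1) ^ p * (?F * (\<Sum>k\<le>Suc q. (- 1) ^ k * ?g k))"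
  proof -
    have f: "?f (Suc p) = ?F"
      using front_face_face_low[of "Suc p" p 0 \<sigma>] front_face_face_high[of p "Suc p" 0 \<sigma>] by simp
    have g: "?g 0 = ?G"
      using back_face_face_high[of 0 q p \<sigma>] back_face_face_low[of p p q \<sigma>] by simp
    have "(\<Sum>k\<le>Suc q. (- 1) ^ k * ?g k) = ?G + (\<Sum>k=1..Suc q. (- 1) ^ k * ?g k)"
      by (simp only: sum.atMost_shift sum.atLeast1_atMost_eq One_nat_def power_0 mult_1 g)
    moreover have "(\<Sum>k\<le>Suc p. (- 1) ^ k * ?f k) = (\<Sum>k\<le>p. (- 1) ^ k * ?f k) - (- 1) ^ p * ?F"
      by (simp add: f)
    moreover have "(\<Sum>k\<le>p. (- 1) ^ k * ?f k * ?G) = (\<Sum>k\<le>p. (- 1) ^ k * ?f k) * ?G"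
      by (simp only: sum_distrib_right)
    moreover have "(\<Sum>k=1..Suc q. (- 1) ^ (p + k) * (?F * ?g k)) =
        (- 1) ^ p * (?F * (\<Sum>k=1..Suc q. (- 1) ^ k * ?g k))"
      by (simp only: sum_distrib_left power_add mult.assoc mult.left_commute[of ?F])
    moreover have "S * G + s * (F * T) = (S - s * F) * G + s * (F * (G + T))" for S T F G s :: 'r
      by (simp add: algebra_simps)
    ultimately show ?thesis by (simp only:)
  qed
  also have "\<dots> = cup (Suc p) q X (coboundary p X \<phi>) \<psi> \<sigma> + (- 1) ^ p * cup p (Suc q) X \<phi> (coboundary q X \<psi>) \<sigma>"
    using True sf sb by (simp add: cup_def coboundary_def del: sum.atMost_Suc)
  finally show ?thesis .
qed (simp add: coboundary_def cup_def)

lemma cup_zero_left [simp]: "cup p q X (\<lambda>\<sigma>. 0) \<psi> = (\<lambda>\<sigma>. 0)"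
  by (rule ext) (simp add: cup_def)

lemma cup_zero_right [simp]: "cup p q X \<phi> (\<lambda>\<sigma>. 0) = (\<lambda>\<sigma>. 0)"
  by (rule ext) (simp add: cup_def)

lemma cup_cocycle:
  assumes "\<phi> \<in> cocycles p X" "\<psi> \<in> cocycles q X"
  shows "cup p q X \<phi> \<psi> \<in> cocycles (p + q) X"
  by (simp add: cocycles_def[of "p + q"] cup_in_cochains coboundary_cup assms[THEN cocycle_coboundary])

lemma unit_cochain_cocycle: "unit_cochain X \<in> cocycles 0 X"
proof -
  have "singular_simplex 0 X (singular_face (Suc 0) k \<sigma>)"
    if "singular_simplex (Suc 0) X \<sigma>" "k \<le> Suc 0" for \<sigma> k
    using singular_simplex_singular_face[OF that(1) _ that(2)] by simp
  then show ?thesis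
    by (auto simp: cocycles_def cochains_def coboundary_def unit_cochain_def)
qed

lemma cup_list_cocycle:
  assumes "\<And>p \<phi>. (p, \<phi>) \<in> set xs \<Longrightarrow> \<phi> \<in> cocycles p X"
  shows "cup_list X xs \<in> cocycles (sum_list (map fst xs)) X"
  using assms
proof (induction X xs rule: cup_list.induct)
  case (1 X)
  then show ?case by (simp add: unit_cochain_cocycle)
next
  case (2 X p \<phi> xs)
  then have "\<phi> \<in> cocycles p X" "cup_list X xs \<in> cocycles (sum_list (map fst xs)) X" by auto
  then show ?case by (simp add: cup_cocycle)
qed

lemma cup_coboundary_left:
  assumes "\<phi> \<in> coboundaries p X" "\<psi> \<in> cocycles q X"
  shows "cup p q X \<phi> \<psi> \<in> coboundaries (p + q) X"
proof (cases p)
  case 0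
  then show ?thesis using assms by (simp add: coboundaries_def[of 0])
next
  case (Suc r)
  then obtain a where "\<phi> = coboundary r X a" using assms by (auto simp: coboundaries_Suc)
  then have "cup p q X \<phi> \<psi> = coboundary (r + q) X (cup r q X a \<psi>)"
    by (intro ext) (simp add: coboundary_cup Suc cocycle_coboundary[OF assms(2)])
  then show ?thesis by (auto simp: Suc coboundaries_Suc cup_in_cochains)
qed

lemma cup_coboundary_right:
  assumes "\<phi> \<in> cocycles p X" "\<psi> \<in> coboundaries q X"
  shows "cup p q X \<phi> \<psi> \<in> coboundaries (p + q) X"
proof (cases q)
  case 0
  then show ?thesis using assms by (simp add: coboundaries_def[of 0])
next
  case (Suc r)
  then obtain a where "\<psi> = coboundary r X a" using assms by (auto simp: coboundaries_Suc)
  then have "coboundary (p + r) X (cup p r X \<phi> a) = (\<lambda>\<sigma>. (- 1) ^ p * cup p q X \<phi> \<psi> \<sigma>)"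
    by (intro ext) (simp add: coboundary_cup Suc cocycle_coboundary[OF assms(1)])
  then have "(\<lambda>\<sigma>. (- 1) ^ p * cup p q X \<phi> \<psi> \<sigma>) \<in> coboundaries (p + q) X"
    by (metis Suc add_Suc_right coboundaries_Suc cup_in_cochains imageI)
  from coboundaries_cmult[OF this, of "(- 1) ^ p"] show ?thesis
    by (simp flip: mult.assoc power_mult_distrib)
qed

definition cohomologous :: "nat \<Rightarrow> 'a topology \<Rightarrow> ('a, 'r::comm_ring_1) cochain \<Rightarrow> ('a, 'r) cochain \<Rightarrow> bool" where
  "cohomologous p X \<phi> \<psi> \<longleftrightarrow> (\<lambda>\<sigma>. \<phi> \<sigma> - \<psi> \<sigma>) \<in> coboundaries p X"

lemma cohomologous_refl [simp]: "cohomologous p X \<phi> \<phi>"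
  by (simp add: cohomologous_def)

lemma cohomologous_trans:
  "cohomologous p X \<phi> \<psi> \<Longrightarrow> cohomologous p X \<psi> \<theta> \<Longrightarrow> cohomologous p X \<phi> \<theta>"
  unfolding cohomologous_def by (drule (1) coboundaries_add) simp

text \<open>The factors are replaced one at a time: the cup product of a cocycle and a coboundary, in
  either order, is a coboundary by the Leibniz rule.\<close>

lemma cohomologous_cup:
  assumes "cohomologous p X \<phi> \<phi>'" "cohomologous q X \<psi> \<psi>'" "\<phi> \<in> cocycles p X" "\<psi>' \<in> cocycles q X"
  shows "cohomologous (p + q) X (cup p q X \<phi> \<psi>) (cup p q X \<phi>' \<psi>')"
proof -
  have "cohomologous (p + q) X (cup p q X \<phi> \<psi>) (cup p q X \<phi> \<psi>')"
  proof -
    have "cup p q X \<phi> (\<lambda>\<sigma>. \<psi> \<sigma> - \<psi>' \<sigma>) = (\<lambda>\<sigma>. cup p q X \<phi> \<psi> \<sigma> - cup p q X \<phi> \<psi>' \<sigma>)"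
      by (rule ext) (simp add: cup_def right_diff_distrib)
    then show ?thesis
      using cup_coboundary_right[OF assms(3) assms(2)[unfolded cohomologous_def]]
      by (simp add: cohomologous_def)
  qed
  moreover have "cohomologous (p + q) X (cup p q X \<phi> \<psi>') (cup p q X \<phi>' \<psi>')"
  proof -
    have "cup p q X (\<lambda>\<sigma>. \<phi> \<sigma> - \<phi>' \<sigma>) \<psi>' = (\<lambda>\<sigma>. cup p q X \<phi> \<psi>' \<sigma> - cup p q X \<phi>' \<psi>' \<sigma>)"
      by (rule ext) (simp add: cup_def left_diff_distrib)
    then show ?thesis
      using cup_coboundary_left[OF assms(1)[unfolded cohomologous_def] assms(4)]
      by (simp add: cohomologous_def)
  qed
  ultimately show ?thesis by (rule cohomologous_trans)
qed

lemma cup_power_cocycle: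
  assumes "\<phi> \<in> cocycles d X"
  shows "cup_list X (replicate l (d, \<phi>)) \<in> cocycles (d * l) X"
  using cup_list_cocycle[of "replicate l (d, \<phi>)" X] assms by (simp add: sum_list_replicate mult.commute)

lemma cohomologous_cup_power:
  assumes "\<phi> \<in> cocycles d X" "\<psi> \<in> cocycles d X" "cohomologous d X \<phi> \<psi>"
  shows "cohomologous (d * l) X (cup_list X (replicate l (d, \<phi>))) (cup_list X (replicate l (d, \<psi>)))"
proof (induction l)
  case (Suc l)
  then show ?case
    using cohomologous_cup[OF assms(3) Suc assms(1) cup_power_cocycle[OF assms(2)]]
    by (simp add: sum_list_replicate mult.commute)
qed simp

lemma coeff_rat_coboundary: "coeff_rat (coboundary p X \<phi>) = coboundary p X (coeff_rat \<phi>)"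
  by (rule ext) (simp add: coeff_rat_def coboundary_def del: sum.atMost_Suc)

lemma coeff_rat_cochain: "\<phi> \<in> cochains p X \<Longrightarrow> coeff_rat \<phi> \<in> cochains p X"
  by (simp add: coeff_rat_def cochains_def)

lemma coeff_rat_cocycle: "\<phi> \<in> cocycles p X \<Longrightarrow> coeff_rat \<phi> \<in> cocycles p X"
  by (auto simp: cocycles_def coeff_rat_cochain simp flip: coeff_rat_coboundary) (simp add: coeff_rat_def)

lemma coeff_rat_in_coboundaries: "\<phi> \<in> coboundaries p X \<Longrightarrow> coeff_rat \<phi> \<in> coboundaries p X"
  by (auto simp: coboundaries_def coeff_rat_coboundary coeff_rat_cochain)
     (simp add: coeff_rat_def)

section \<open>Bases of abelian groups and primitive elements\<close>

context comm_group
begin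

lemma int_combination_Suc:
  assumes "\<And>i. i < Suc b \<Longrightarrow> \<tau> i \<in> carrier G"
  shows "int_combination G (Suc b) \<tau> k = \<tau> b [^] k b \<otimes> int_combination G b \<tau> k"
  using assms by (simp add: int_combination_def lessThan_Suc Pi_def)

lemma int_combination_0 [simp]: "int_combination G 0 \<tau> k = \<one>"
  by (simp add: int_combination_def)

lemma int_combination_closed:
  assumes "\<And>i. i < b \<Longrightarrow> \<tau> i \<in> carrier G"
  shows "int_combination G b \<tau> k \<in> carrier G"
  unfolding int_combination_def using assms by (intro finprod_closed) auto

lemma int_combination_cong:
  assumes "\<And>i. i < b \<Longrightarrow> \<tau> i \<in> carrier G" "\<And>i. i < b \<Longrightarrow> k i = k' i"
  shows "int_combination G b \<tau> k = int_combination G b \<tau> k'"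
  unfolding int_combination_def using assms by (intro finprod_cong') auto

lemma int_combination_scaled:
  assumes "\<And>i. i < b \<Longrightarrow> \<tau> i \<in> carrier G" "\<And>i. i < b \<Longrightarrow> \<eta> i = \<tau> i [^] d i"
  shows "int_combination G b \<eta> k = int_combination G b \<tau> (\<lambda>i. d i * k i)"
  unfolding int_combination_def using assms by (intro finprod_cong') (auto simp: int_pow_pow)

lemma int_combination_pow:
  assumes "\<And>i. i < b \<Longrightarrow> \<tau> i \<in> carrier G"
  shows "int_combination G b \<tau> k [^] (m::int) = int_combination G b \<tau> (\<lambda>i. m * k i)"
  using assms
proof (induction b)
  case (Suc b)
  then have "\<tau> b \<in> carrier G" "int_combination G b \<tau> k \<in> carrier G"
    by (auto intro: int_combination_closed)
  then show ?case
    using Suc by (simp add: int_combination_Suc int_pow_distrib int_pow_pow mult.commute)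
qed simp

lemma int_combination_uminus:
  assumes "\<And>i. i < b \<Longrightarrow> \<tau> i \<in> carrier G"
  shows "int_combination G b \<tau> (\<lambda>i. - k i) = inv (int_combination G b \<tau> k)"
  using int_combination_pow[OF assms, where k = k and m = "-1"] int_combination_closed[OF assms, where k = k]
  by (simp add: int_pow_neg)

lemma torsion_subgroup: "subgroup (torsion G) G"
proof (rule subgroupI)
  fix a assume "a \<in> torsion G"
  then show "inv a \<in> torsion G" by (auto simp: torsion_def nat_pow_inv)
next
  fix a b assume "a \<in> torsion G" "b \<in> torsion G"
  then obtain m l where ml: "a \<in> carrier G" "b \<in> carrier G" "0 < m" "0 < l" "a [^] (m::nat) = \<one>" "b [^] (l::nat) = \<one>"
    by (auto simp: torsion_def)
  have "(a \<otimes> b) [^] (m * l) = (a [^] m) [^] l \<otimes> (b [^] l) [^] m"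
    using ml(1,2) by (simp add: nat_pow_distrib nat_pow_pow mult.commute)
  also have "\<dots> = \<one>" by (simp add: ml)
  finally have "(a \<otimes> b) [^] (m * l) = \<one>" .
  with ml show "a \<otimes> b \<in> torsion G"
    unfolding torsion_def by (intro CollectI conjI exI[of _ "m * l"]) auto
qed (auto simp: torsion_def intro!: exI[of _ 1])

lemma basis_coordinates_unique:
  assumes "is_basis G b \<tau>" "int_combination G b \<tau> k = int_combination G b \<tau> k'" "i < b"
  shows "k i = k' i"
proof -
  have \<tau>: "\<And>i. i < b \<Longrightarrow> \<tau> i \<in> carrier G" using assms(1) by (simp add: is_basis_def)
  have r: "int_combination G b \<tau> (restrict h {..<b}) = int_combination G b \<tau> h" for h
    by (rule int_combination_cong[OF \<tau>]) auto
  have ex1: "\<exists>!h. h \<in> extensional {..<b} \<and> int_combination G b \<tau> k = int_combination G b \<tau> h"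
    using assms(1) int_combination_closed[OF \<tau>] by (simp add: is_basis_def)
  have "restrict k {..<b} = restrict k' {..<b}"
    by (rule ex1E[OF ex1], metis assms(2) r restrict_extensional)
  then show ?thesis using assms(3) by (metis lessThan_iff restrict_apply')
qed

lemma basis_coordinates_exist:
  assumes "is_basis G b \<tau>" "x \<in> carrier G"
  obtains k where "x = int_combination G b \<tau> k"
  using assms unfolding is_basis_def by blast

text \<open>This identifies the index of an almost complex manifold. With respect to a basis, an
  element is a \<open>k\<close>-th multiple only if \<open>k\<close> divides all its coordinates, and dividing them by their
  greatest common divisor leaves a primitive element.\<close>

lemma greatest_primitive_multiple:
  assumes basis: "is_basis G b \<tau>" and pos: "\<And>i. i < b \<Longrightarrow> 0 < N i" and b: "0 < b"
  shows "(GREATEST k. \<exists>\<eta>. primitive G \<eta> \<and> int_combination G b \<tau> N = \<eta> [^] (k::int)) = Gcd (N ` {..<b})"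
    (is "_ = ?g")
proof (rule Greatest_equality)
  have \<tau>: "\<And>i. i < b \<Longrightarrow> \<tau> i \<in> carrier G" using basis by (simp add: is_basis_def)
  have "?g dvd N 0" using b by (intro Gcd_dvd) auto
  moreover have "0 < N 0" using pos b by simp
  ultimately have g: "0 < ?g"
    by (metis Gcd_int_greater_eq_0 dvd_0_left_iff order_le_less less_irrefl)
  have N: "?g * (N i div ?g) = N i" if "i < b" for i
    using that by (intro dvd_mult_div_cancel Gcd_dvd) auto
  let ?\<eta> = "int_combination G b \<tau> (\<lambda>i. N i div ?g)"
  have "primitive G ?\<eta>"
    unfolding primitive_def
  proof (intro conjI ballI allI impI int_combination_closed \<tau>)
    fix y m assume y: "y \<in> carrier G" "?\<eta> = y [^] (m::int)"
    obtain h where h: "y = int_combination G b \<tau> h"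
      using basis_coordinates_exist[OF basis y(1)] .
    have "?g * m dvd N i" if "i < b" for i
    proof -
      have "N i div ?g = m * h i"
        using basis_coordinates_unique[OF basis _ that] y(2) by (simp add: h int_combination_pow \<tau>)
      then have "N i = ?g * m * h i" using N[OF that] by (simp add: mult.assoc)
      then show ?thesis by simp
    qed
    then have "?g * m dvd ?g" by (intro Gcd_greatest) auto
    then have "?g * m dvd ?g * 1" by simp
    then show "\<bar>m\<bar> = 1" using g dvd_mult_cancel_left[of ?g m 1] by (metis less_irrefl zdvd1_eq)
  qed
  moreover have "int_combination G b \<tau> N = ?\<eta> [^] ?g"
    by (simp only: int_combination_pow[OF \<tau>]) (rule int_combination_cong[OF \<tau>], simp_all only: N)
  ultimately show "\<exists>\<eta>. primitive G \<eta> \<and> int_combination G b \<tau> N = \<eta> [^] ?g" by blast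
  fix k assume "\<exists>\<eta>. primitive G \<eta> \<and> int_combination G b \<tau> N = \<eta> [^] (k::int)"
  then obtain \<eta> where \<eta>: "\<eta> \<in> carrier G" "int_combination G b \<tau> N = \<eta> [^] k" by (auto simp: primitive_def)
  obtain h where h: "\<eta> = int_combination G b \<tau> h"
    using basis_coordinates_exist[OF basis \<eta>(1)] .
  have "N i = k * h i" if "i < b" for i
    using basis_coordinates_unique[OF basis _ that] \<eta>(2) by (simp add: h int_combination_pow \<tau>)
  then have "k dvd ?g" by (intro Gcd_greatest) auto
  then show "k \<le> ?g" using g by (rule zdvd_imp_le)
qed

end

lemma hom_int_combination:
  assumes "comm_group G" "comm_group H" "h \<in> hom G H" "\<And>i. i < b \<Longrightarrow> z i \<in> carrier G"
  shows "h (int_combination G b z k) = int_combination H b (\<lambda>i. h (z i)) k"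
proof -
  interpret G: comm_group G by fact
  interpret H: comm_group H by fact
  interpret group_hom G H h by unfold_locales fact
  from assms(4) show ?thesis
  proof (induction b)
    case (Suc b)
    then show ?case
      by (simp add: G.int_combination_Suc H.int_combination_Suc G.int_combination_closed hom_int_pow)
  qed simp
qed

section \<open>Second cohomology modulo torsion\<close>

lemma cocycle_group_simps [simp]:
  "carrier (cocycle_group p X) = cocycles p X"
  "\<phi> \<otimes>\<^bsub>cocycle_group p X\<^esub> \<psi> = (\<lambda>\<sigma>. \<phi> \<sigma> + \<psi> \<sigma>)"
  "\<one>\<^bsub>cocycle_group p X\<^esub> = (\<lambda>\<sigma>. 0)"
  by (simp_all add: cocycle_group_def)

lemma comm_group_cocycle_group: "comm_group (cocycle_group p X)"
proof (rule comm_groupI)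
  fix \<phi> assume "\<phi> \<in> carrier (cocycle_group p X)"
  then show "\<exists>\<psi>\<in>carrier (cocycle_group p X). \<psi> \<otimes>\<^bsub>cocycle_group p X\<^esub> \<phi> = \<one>\<^bsub>cocycle_group p X\<^esub>"
    using cocycles_cmult[of \<phi> p X "-1"] by (intro bexI[of _ "\<lambda>\<sigma>. - \<phi> \<sigma>"]) auto
qed (auto simp: cocycles_add add.assoc add.commute)

lemma inv_cocycle_group:
  assumes "\<phi> \<in> cocycles p X"
  shows "inv\<^bsub>cocycle_group p X\<^esub> \<phi> = (\<lambda>\<sigma>. - \<phi> \<sigma>)"
proof -
  interpret comm_group "cocycle_group p X" by (rule comm_group_cocycle_group)
  show ?thesis
    using assms cocycles_cmult[OF assms, of "-1"] by (intro inv_equality) auto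
qed

lemma nat_pow_cocycle_group: "\<phi> [^]\<^bsub>cocycle_group p X\<^esub> (m::nat) = (\<lambda>\<sigma>. int m * \<phi> \<sigma>)"
  by (induction m) (auto simp: nat_pow_def algebra_simps)

lemma int_pow_cocycle_group:
  assumes "\<phi> \<in> cocycles p X"
  shows "\<phi> [^]\<^bsub>cocycle_group p X\<^esub> (m::int) = (\<lambda>\<sigma>. m * \<phi> \<sigma>)"
  using assms cocycles_cmult[OF assms, of "- m"]
  by (auto simp: int_pow_def2 nat_pow_cocycle_group inv_cocycle_group)

lemma int_combination_cocycle_group:
  assumes "\<And>i. i < b \<Longrightarrow> z i \<in> cocycles p X"
  shows "int_combination (cocycle_group p X) b z k = (\<lambda>\<sigma>. \<Sum>i<b. k i * z i \<sigma>)"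
proof -
  interpret comm_group "cocycle_group p X" by (rule comm_group_cocycle_group)
  from assms show ?thesis
    by (induction b) (simp_all add: int_combination_Suc int_pow_cocycle_group add.commute)
qed

lemma coboundaries_subgroup: "subgroup (coboundaries p X) (cocycle_group p X)"
proof -
  interpret comm_group "cocycle_group p X" by (rule comm_group_cocycle_group)
  show ?thesis
  proof (rule subgroupI)
    show "coboundaries p X \<subseteq> carrier (cocycle_group p X)" by (simp add: coboundaries_subset_cocycles)
    show "coboundaries p X \<noteq> {}" using zero_in_coboundaries by blast
  next
    fix \<phi> :: "('a, int) cochain" assume "\<phi> \<in> coboundaries p X"
    then show "inv\<^bsub>cocycle_group p X\<^esub> \<phi> \<in> coboundaries p X"
      using coboundaries_cmult[of \<phi> p X "-1"]
      by (simp add: inv_cocycle_group[OF subsetD[OF coboundaries_subset_cocycles]])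
  qed (simp add: coboundaries_add)
qed

lemma comm_group_cohomology_group: "comm_group (cohomology_group p X)"
  unfolding cohomology_group_def
  by (intro comm_group.abelian_FactGroup comm_group_cocycle_group coboundaries_subgroup)

lemma comm_group_H2_mod_torsion: "comm_group (H2_mod_torsion X)"
  unfolding H2_mod_torsion_def
  by (intro comm_group.abelian_FactGroup comm_group.torsion_subgroup comm_group_cohomology_group)

lemma coset_hom:
  assumes "comm_group G" "subgroup N G"
  shows "(\<lambda>x. N #>\<^bsub>G\<^esub> x) \<in> hom G (G Mod N)"
  using assms by (simp add: comm_group.subgroup_imp_normal normal.r_coset_hom_Mod)

lemma class_mod_torsion_hom: "class_mod_torsion X \<in> hom (cocycle_group 2 X) (H2_mod_torsion X)"
proof -
  have "(\<lambda>y. torsion (cohomology_group 2 X) #>\<^bsub>cohomology_group 2 X\<^esub> y) \<circ>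
        (\<lambda>z. coboundaries 2 X #>\<^bsub>cocycle_group 2 X\<^esub> z) \<in> hom (cocycle_group 2 X) (H2_mod_torsion X)"
    unfolding H2_mod_torsion_def
    by (rule Group.hom_compose[of _ _ "cohomology_group 2 X"])
       (auto simp: cohomology_group_def intro!: coset_hom comm_group_cocycle_group coboundaries_subgroup
           comm_group.torsion_subgroup comm_group_cohomology_group[unfolded cohomology_group_def])
  then show ?thesis by (simp add: comp_def class_mod_torsion_def[abs_def])
qed

lemma class_mod_torsion_surj:
  assumes "x \<in> carrier (H2_mod_torsion X)"
  obtains z where "z \<in> cocycles 2 X" "x = class_mod_torsion X z"
  using assms
  by (auto simp: H2_mod_torsion_def cohomology_group_def carrier_FactGroup class_mod_torsion_def)

text \<open>Integral combinations of classes are represented by the pointwise combinations of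
  cocycles; this is the formula in which the coefficients enter polynomially.\<close>

lemma class_mod_torsion_combination:
  assumes "\<And>i. i < b \<Longrightarrow> z i \<in> cocycles 2 X"
  shows "int_combination (H2_mod_torsion X) b (\<lambda>i. class_mod_torsion X (z i)) k =
         class_mod_torsion X (\<lambda>\<sigma>. \<Sum>i<b. k i * z i \<sigma>)"
  using hom_int_combination[OF comm_group_cocycle_group comm_group_H2_mod_torsion class_mod_torsion_hom, of b z X k]
    assms
  by (simp add: int_combination_cocycle_group)

section \<open>The index map is a polynomial function\<close>

text \<open>Products of cocycles are cocycles, and the restriction to monomials of weight \<open>k\<close> puts all
  of them in degree \<open>2k\<close>.\<close>

lemma todd_cocycle_cocycle:
  assumes "\<And>k. c k \<in> cocycles (2 * k) X"
  shows "todd_cocycle X n c k \<in> cocycles (2 * k) X"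
  unfolding todd_cocycle_def
proof (intro cocycles_sum cocycles_cmult)
  fix m :: "nat \<Rightarrow>\<^sub>0 nat"
  let ?xs = "concat (map (\<lambda>i. replicate (Poly_Mapping.lookup m i) (2 * i, coeff_rat (c i))) [1..<Suc n])"
  assume "m \<in> {m. Poly_Mapping.keys m \<subseteq> {1..n} \<and> (\<Sum>i=1..n. i * Poly_Mapping.lookup m i) = k}"
  then have k: "(\<Sum>i=1..n. i * Poly_Mapping.lookup m i) = k" by simp
  have "sum_list (map fst ?xs) = (\<Sum>i\<leftarrow>[1..<Suc n]. 2 * (i * Poly_Mapping.lookup m i))"
    by (induction n) (simp_all add: map_concat sum_list_replicate)
  also have "\<dots> = (\<Sum>i=1..n. 2 * (i * Poly_Mapping.lookup m i))"
    by (simp only: interv_sum_list_conv_sum_set_nat set_upt atLeastLessThanSuc_atLeastAtMost)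
  also have "\<dots> = 2 * k" using k by (simp flip: sum_distrib_left)
  finally have deg: "sum_list (map fst ?xs) = 2 * k" .
  have "\<phi> \<in> cocycles p X" if "(p, \<phi>) \<in> set ?xs" for p \<phi>
    using that by (auto simp del: upt_Suc simp: coeff_rat_cocycle assms)
  from cup_list_cocycle[of ?xs X, OF this] show "cup_list X ?xs \<in> cocycles (2 * k) X"
    unfolding deg .
qed

text \<open>A multiple of \<open>w - z\<close> by a positive integer bounds integrally, so \<open>w\<close> and \<open>z\<close> are
  cohomologous over the rationals, where the index is computed.\<close>

lemma index_of_cocycle_cong:
  assumes c: "\<And>k. c k \<in> cocycles (2 * k) X" and \<mu>: "singular_relcycle (2 * n) X {} \<mu>"
    and z: "z \<in> cocycles 2 X" "w \<in> cocycles 2 X"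
    and torsion: "0 < m" "(\<lambda>\<sigma>. int m * (w \<sigma> - z \<sigma>)) \<in> coboundaries 2 X"
  shows "index_of_cocycle X n c \<mu> w = index_of_cocycle X n c \<mu> z"
  unfolding index_of_cocycle_def
proof (intro sum.cong arg_cong2[of _ _ _ _ "(/)"] refl)
  fix l assume "l \<in> {..n}"
  have zw: "coeff_rat z \<in> cocycles 2 X" "coeff_rat w \<in> cocycles 2 X"
    using z by (auto intro: coeff_rat_cocycle)
  have "(\<lambda>\<sigma>. inverse (of_nat m) * coeff_rat (\<lambda>\<sigma>. int m * (w \<sigma> - z \<sigma>)) \<sigma>) \<in> coboundaries 2 X"
    by (intro coboundaries_cmult coeff_rat_in_coboundaries torsion)
  moreover have "(\<lambda>\<sigma>. inverse (of_nat m) * coeff_rat (\<lambda>\<sigma>. int m * (w \<sigma> - z \<sigma>)) \<sigma>) =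
      (\<lambda>\<sigma>. coeff_rat w \<sigma> - coeff_rat z \<sigma>)"
    using torsion(1) by (simp add: coeff_rat_def flip: mult.assoc)
  ultimately have "cohomologous 2 X (coeff_rat w) (coeff_rat z)"
    by (simp add: cohomologous_def)
  then have "cohomologous (2 * l) X (cup_list X (replicate l (2, coeff_rat w))) (cup_list X (replicate l (2, coeff_rat z)))"
    by (intro cohomologous_cup_power zw)
  then have "cohomologous (2 * l + 2 * (n - l)) X
      (cup (2 * l) (2 * (n - l)) X (cup_list X (replicate l (2, coeff_rat w))) (todd_cocycle X n c (n - l)))
      (cup (2 * l) (2 * (n - l)) X (cup_list X (replicate l (2, coeff_rat z))) (todd_cocycle X n c (n - l)))"
    by (intro cohomologous_cup cup_power_cocycle zw todd_cocycle_cocycle c) auto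
  moreover have "2 * l + 2 * (n - l) = 2 * n" using \<open>l \<in> {..n}\<close> by auto
  ultimately have "evaluate (\<lambda>\<sigma>.
      cup (2 * l) (2 * (n - l)) X (cup_list X (replicate l (2, coeff_rat w))) (todd_cocycle X n c (n - l)) \<sigma> -
      cup (2 * l) (2 * (n - l)) X (cup_list X (replicate l (2, coeff_rat z))) (todd_cocycle X n c (n - l)) \<sigma>) \<mu> = 0"
    by (intro evaluate_coboundaries[OF _ \<mu>]) (simp add: cohomologous_def)
  then show "evaluate (cup (2 * l) (2 * (n - l)) X (cup_list X (replicate l (2, coeff_rat w))) (todd_cocycle X n c (n - l))) \<mu> =
      evaluate (cup (2 * l) (2 * (n - l)) X (cup_list X (replicate l (2, coeff_rat z))) (todd_cocycle X n c (n - l))) \<mu>"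
    by (simp add: evaluate_def right_diff_distrib sum_subtractf)
qed

text \<open>Every member of a member of the class modulo torsion differs from \<open>z\<close> by the sum of a
  coboundary and a cocycle some multiple of which is a coboundary, hence has the same index as \<open>z\<close>.
  So the two nested images, of which the index map picks the only element, are singletons.\<close>

lemma index_map_class:
  assumes c: "\<And>k. c k \<in> cocycles (2 * k) X" and \<mu>: "singular_relcycle (2 * n) X {} \<mu>"
    and z: "z \<in> cocycles 2 X"
  shows "index_map X n c \<mu> (class_mod_torsion X z) = index_of_cocycle X n c \<mu> z"
proof -
  let ?C = "cocycle_group 2 X" and ?B = "coboundaries 2 X" and ?H = "cohomology_group 2 X"
  interpret C: comm_group ?C by (rule comm_group_cocycle_group)
  interpret H: comm_group ?H by (rule comm_group_cohomology_group)
  interpret B: normal ?B ?C by (intro C.subgroup_imp_normal coboundaries_subgroup)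
  have B0: "(\<lambda>\<sigma>. 0) \<in> ?B" by simp
  have coset: "?B #>\<^bsub>?C\<^esub> w = {\<lambda>\<sigma>. b \<sigma> + w \<sigma> |b. b \<in> ?B}" for w
    by (auto simp: r_coset_def)
  have "index_H2 X n c \<mu> E = index_of_cocycle X n c \<mu> z" if E_in: "E \<in> class_mod_torsion X z" for E
  proof -
    obtain t where t: "t \<in> torsion ?H" "E = t \<otimes>\<^bsub>?H\<^esub> (?B #>\<^bsub>?C\<^esub> z)"
      using E_in by (auto simp: class_mod_torsion_def r_coset_def[of ?H])
    then obtain u where u: "u \<in> cocycles 2 X" "t = ?B #>\<^bsub>?C\<^esub> u"
      by (auto simp: torsion_def cohomology_group_def carrier_FactGroup)
    obtain m :: nat where m: "0 < m" "t [^]\<^bsub>?H\<^esub> m = \<one>\<^bsub>?H\<^esub>" using t(1) by (auto simp: torsion_def)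
    have "?B #>\<^bsub>?C\<^esub> (u [^]\<^bsub>?C\<^esub> m) = ?B"
      using m(2) u by (simp add: cohomology_group_def B.FactGroup_pow)
    then have mu: "(\<lambda>\<sigma>. int m * u \<sigma>) \<in> ?B"
      unfolding coset nat_pow_cocycle_group using B0 by force
    have E: "E = ?B #>\<^bsub>?C\<^esub> (\<lambda>\<sigma>. u \<sigma> + z \<sigma>)"
      using t(2) u z B.rcos_sum[of u z] by (simp add: cohomology_group_def)
    have "index_of_cocycle X n c \<mu> w = index_of_cocycle X n c \<mu> z" if "w \<in> E" for w
    proof -
      obtain b where b: "b \<in> ?B" "w = (\<lambda>\<sigma>. b \<sigma> + (u \<sigma> + z \<sigma>))"
        using \<open>w \<in> E\<close> by (auto simp: E coset)
      then have "w \<in> cocycles 2 X"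
        using u(1) z coboundaries_subset_cocycles by (auto intro!: cocycles_add)
      moreover have "(\<lambda>\<sigma>. int m * (w \<sigma> - z \<sigma>)) \<in> ?B"
        using coboundaries_add[OF coboundaries_cmult[OF b(1), of "int m"] mu]
        by (simp add: b(2) algebra_simps)
      ultimately show ?thesis
        using index_of_cocycle_cong[OF c \<mu> z _ m(1)] by blast
    qed
    moreover have "E \<noteq> {}" using B0 unfolding E coset by blast
    ultimately have "index_of_cocycle X n c \<mu> ` E = {index_of_cocycle X n c \<mu> z}" by auto
    then show ?thesis by (simp add: index_H2_def)
  qed
  moreover have "class_mod_torsion X z \<noteq> {}"
    using H.torsion_subgroup[THEN subgroup.one_closed] by (auto simp: class_mod_torsion_def r_coset_def[of ?H])
  ultimately have "index_H2 X n c \<mu> ` class_mod_torsion X z = {index_of_cocycle X n c \<mu> z}" by auto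
  then show ?thesis by (simp add: index_map_def)
qed

text \<open>In each step the definition of the cup product multiplies by one value of the combination,
  which is linear in the coefficients. Working on a fixed simplex avoids expanding the power in
  cohomology.\<close>

lemma cup_power_combination_polynomial:
  "integer_polynomial b l (\<lambda>k. cup_list X (replicate l (d, coeff_rat (\<lambda>\<rho>. \<Sum>i<b. k i * z i \<rho>))) \<sigma>)"
proof (induction l arbitrary: \<sigma>)
  case 0
  then show ?case by (simp add: integer_polynomial_const)
next
  case (Suc l)
  let ?w = "\<lambda>k. cup_list X (replicate l (d, coeff_rat (\<lambda>\<rho>. \<Sum>i<b. k i * z i \<rho>)))"
  have "integer_polynomial b (Suc l) (\<lambda>k. \<Sum>i<b. of_int (k i) *
      (of_int (z i (front_face d \<sigma>)) * ?w k (back_face d (l * d) \<sigma>)))"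
    by (intro integer_polynomial_sum integer_polynomial_coordinate_mult integer_polynomial_cmult Suc) auto
  moreover have "(\<lambda>k. cup_list X (replicate (Suc l) (d, coeff_rat (\<lambda>\<rho>. \<Sum>i<b. k i * z i \<rho>))) \<sigma>) =
     (\<lambda>k. if singular_simplex (d + l * d) X \<sigma> then \<Sum>i<b. of_int (k i) *
      (of_int (z i (front_face d \<sigma>)) * ?w k (back_face d (l * d) \<sigma>)) else 0)"
    by (rule ext) (simp add: cup_def coeff_rat_def sum_list_replicate sum_distrib_right mult.assoc)
  ultimately show ?case
    by (cases "singular_simplex (d + l * d) X \<sigma>") (simp_all only: if_True if_False integer_polynomial_const)
qed

lemma index_of_combination_polynomial:
  "integer_polynomial b n (\<lambda>k. index_of_cocycle X n c \<mu> (\<lambda>\<sigma>. \<Sum>i<b. k i * z i \<sigma>))"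
proof -
  let ?w = "\<lambda>l k. cup_list X (replicate l (2, coeff_rat (\<lambda>\<sigma>. \<Sum>i<b. k i * z i \<sigma>)))"
  let ?t = "\<lambda>l \<sigma>. todd_cocycle X n c (n - l) (back_face (2 * l) (2 * (n - l)) \<sigma>)"
  have "integer_polynomial b n (\<lambda>k. \<Sum>l\<le>n. \<Sum>\<sigma>\<in>Poly_Mapping.keys \<mu>.
     (of_int (Poly_Mapping.lookup \<mu> \<sigma>) * (if singular_simplex (2 * l + 2 * (n - l)) X \<sigma> then ?t l \<sigma> else 0) / fact l) *
        ?w l k (front_face (2 * l) \<sigma>))"
    by (intro integer_polynomial_sum integer_polynomial_cmult
        integer_polynomial_mono[OF cup_power_combination_polynomial]) auto
  moreover have "index_of_cocycle X n c \<mu> (\<lambda>\<sigma>. \<Sum>i<b. k i * z i \<sigma>) = (\<Sum>l\<le>n. \<Sum>\<sigma>\<in>Poly_Mapping.keys \<mu>.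
     (of_int (Poly_Mapping.lookup \<mu> \<sigma>) * (if singular_simplex (2 * l + 2 * (n - l)) X \<sigma> then ?t l \<sigma> else 0) / fact l) *
        ?w l k (front_face (2 * l) \<sigma>))" for k
    unfolding index_of_cocycle_def evaluate_def sum_divide_distrib
    by (intro sum.cong refl) (simp add: cup_def)
  ultimately show ?thesis by simp
qed

text \<open>The index of a combination of the \<open>\<tau> i\<close> is given by a polynomial of degree at most \<open>n\<close>; being
  determined by its values at integer points, it is the one that the definite description selects.\<close>

lemma hilbert_polynomial_properties:
  assumes c: "\<And>k. c k \<in> cocycles (2 * k) X" and \<mu>: "singular_relcycle (2 * n) X {} \<mu>"
    and \<tau>: "\<And>i. i < b \<Longrightarrow> \<tau> i \<in> carrier (H2_mod_torsion X)"
  shows "in_variables {..<b} (hilbert_polynomial X n c \<mu> b \<tau>)"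
    and "total_degree (hilbert_polynomial X n c \<mu> b \<tau>) \<le> n"
    and "poly_eval (hilbert_polynomial X n c \<mu> b \<tau>) (\<lambda>i. of_int (k i)) =
      index_map X n c \<mu> (int_combination (H2_mod_torsion X) b \<tau> k)"
proof -
  interpret L: comm_group "H2_mod_torsion X" by (rule comm_group_H2_mod_torsion)
  have "\<exists>z. z \<in> cocycles 2 X \<and> \<tau> i = class_mod_torsion X z" if "i < b" for i
    using class_mod_torsion_surj[OF \<tau>[OF that]] by blast
  then obtain z where z: "\<And>i. i < b \<Longrightarrow> z i \<in> cocycles 2 X"
      "\<And>i. i < b \<Longrightarrow> \<tau> i = class_mod_torsion X (z i)"
    by metis
  have f: "index_map X n c \<mu> (int_combination (H2_mod_torsion X) b \<tau> k) =
      index_of_cocycle X n c \<mu> (\<lambda>\<sigma>. \<Sum>i<b. k i * z i \<sigma>)" for k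
  proof -
    have "int_combination (H2_mod_torsion X) b \<tau> k =
        int_combination (H2_mod_torsion X) b (\<lambda>i. class_mod_torsion X (z i)) k"
      unfolding int_combination_def using \<tau> z(2) by (intro L.finprod_cong') auto
    moreover have "(\<lambda>\<sigma>. \<Sum>i<b. k i * z i \<sigma>) \<in> cocycles 2 X"
      using z(1) by (intro cocycles_sum cocycles_cmult) auto
    ultimately show ?thesis
      using z(1) by (simp add: class_mod_torsion_combination index_map_class[OF c \<mu>])
  qed
  let ?Q = "\<lambda>H. in_variables {..<b} H \<and> (\<forall>k. poly_eval H (\<lambda>i. of_int (k i)) =
      index_map X n c \<mu> (int_combination (H2_mod_torsion X) b \<tau> k))"
  obtain P where P: "?Q P" "total_degree P \<le> n"
    using index_of_combination_polynomial[of b n X c \<mu> z] unfolding integer_polynomial_def f by metis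
  have "Q = P" if "?Q Q" for Q
  proof -
    have "Poly_Mapping.keys (Q - P) \<subseteq> Poly_Mapping.keys Q \<union> Poly_Mapping.keys P" by (rule keys_diff)
    then have "in_variables {..<b} (Q - P)" using P \<open>?Q Q\<close> unfolding in_variables_def by blast
    then have "Q - P = 0"
      using P \<open>?Q Q\<close> by (intro integer_point_identity[of b]) (simp_all add: poly_eval_diff)
    then show ?thesis by simp
  qed
  with P(1) have "hilbert_polynomial X n c \<mu> b \<tau> = P"
    unfolding hilbert_polynomial_def by (intro the_equality) blast+
  with P show "in_variables {..<b} (hilbert_polynomial X n c \<mu> b \<tau>)"
    "total_degree (hilbert_polynomial X n c \<mu> b \<tau>) \<le> n"
    "poly_eval (hilbert_polynomial X n c \<mu> b \<tau>) (\<lambda>i. of_int (k i)) =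
      index_map X n c \<mu> (int_combination (H2_mod_torsion X) b \<tau> k)"
    by auto
qed

section \<open>The Mukai inequality\<close>

theorem corollary2p8:
  fixes X :: "'a topology" and A :: "'a chart set" and J :: "'a endo_field"
    and n b2 :: nat and k0 :: int
    and c :: "nat \<Rightarrow> ('a, int) cochain" and \<mu> :: "'a chain"
    and c1 :: "('a, int) cochain set set"
    and \<tau> \<eta> :: "nat \<Rightarrow> ('a, int) cochain set set"
    and N :: "nat \<Rightarrow> int"
  assumes manifold: "smooth_manifold (2 * n) X A"
    and compact: "compact_space X"
    and connected: "connected_space X" "topspace X \<noteq> {}"
    and almost_complex: "almost_complex_structure (2 * n) A J"
    and chern: "chern_cocycles (tangent_bundle (2 * n) X A J) n c"
    and fundamental: "fundamental_cycle n X A J \<mu>"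
    and b2: "b2 = betti_number 2 X"
    and c1: "c1 = class_mod_torsion X (c 1)"
    and k0: "k0 = manifold_index X c1"
    and basis: "is_basis (H2_mod_torsion X) b2 \<tau>"
    and c1_eq: "c1 = int_combination (H2_mod_torsion X) b2 \<tau> N"
    and N_pos: "\<And>i. i < b2 \<Longrightarrow> 0 < N i"
    and \<eta>: "\<And>i. i < b2 \<Longrightarrow> \<eta> i = \<tau> i [^]\<^bsub>H2_mod_torsion X\<^esub> (N i div k0)"
    and nonzero: "index_map X n c \<mu> (inv\<^bsub>H2_mod_torsion X\<^esub> c1) \<noteq> 0"
    and vanishing: "\<And>k :: nat \<Rightarrow> int.
          (\<And>i. i < b2 \<Longrightarrow> 0 < k i \<and> k i \<le> k0) \<Longrightarrow> (\<Sum>i<b2. k i) < k0 * int b2 \<Longrightarrow>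
          index_map X n c \<mu> (int_combination (H2_mod_torsion X) b2 \<eta> (\<lambda>i. - k i)) = 0"
  shows "int b2 * (k0 - 1) \<le> int n \<and>
    total_degree (hilbert_polynomial X n c \<mu> b2 \<tau>) \<le> n \<and>
    int b2 * (k0 - 1) \<le> int (total_degree (hilbert_polynomial X n c \<mu> b2 \<tau>))"
proof -
  let ?H = "hilbert_polynomial X n c \<mu> b2 \<tau>"
  interpret L: comm_group "H2_mod_torsion X" by (rule comm_group_H2_mod_torsion)
  have c: "\<And>k. c k \<in> cocycles (2 * k) X"
    using chern by (simp add: chern_cocycles_def tangent_bundle_def)
  have \<mu>: "singular_relcycle (2 * n) X {} \<mu>"
    using fundamental by (simp add: fundamental_cycle_def)
  have \<tau>: "\<And>i. i < b2 \<Longrightarrow> \<tau> i \<in> carrier (H2_mod_torsion X)"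
    using basis by (simp add: is_basis_def)
  note H = hilbert_polynomial_properties[where b = b2 and \<tau> = \<tau>, OF c \<mu> \<tau>]
  \<comment> \<open>If \<open>b2 = 0\<close>, then \<open>c1\<close> is zero and its index is unspecified, but the bound is zero too.\<close>
  have "int b2 * (k0 - 1) \<le> int (total_degree ?H)"
  proof (cases "b2 = 0")
    case False
    have g: "k0 = Gcd (N ` {..<b2})"
      unfolding k0 manifold_index_def c1_eq
      using L.greatest_primitive_multiple[OF basis N_pos] False by simp
    have "k0 \<noteq> 0" using N_pos[of 0] False by (force simp: g)
    moreover have "k0 \<ge> 0" unfolding g by simp
    ultimately have k0_pos: "0 < k0" by simp
    define d where "d = (\<lambda>i. N i div k0)"
    have d: "d i * k0 = N i" if "i < b2" for i
      unfolding d_def using that by (intro dvd_div_mult_self) (auto simp: g)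
    \<comment> \<open>The box starts at the multiples \<open>k\<^sub>i = 1\<close>, so \<open>k\<^sub>i = j + 1\<close> with \<open>j \<le> K\<close>.\<close>
    define K where "K = nat (k0 - 1)"
    have K: "int K = k0 - 1" using k0_pos by (simp add: K_def)
    have "(\<Sum>i<b2. K) \<le> total_degree ?H"
    proof (rule degree_from_box_vanishing[where \<alpha> = "\<lambda>i. - of_int (d i)" and \<beta> = "\<lambda>i. - of_int (d i)"])
      show "in_variables {..<b2} ?H" by (rule H(1))
    next
      fix k :: "nat \<Rightarrow> nat"
      assume k: "\<And>i. i < b2 \<Longrightarrow> k i \<le> K" "\<exists>i<b2. k i < K"
      let ?k = "\<lambda>i. int (k i) + 1"
      have "(\<Sum>i<b2. ?k i) < (\<Sum>i<b2. k0)"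
        using k K by (intro sum_strict_mono_ex1) force+
      moreover have "0 < ?k i \<and> ?k i \<le> k0" if "i < b2" for i
        using k(1)[OF that] K by linarith
      ultimately have "index_map X n c \<mu> (int_combination (H2_mod_torsion X) b2 \<eta> (\<lambda>i. - ?k i)) = 0"
        by (intro vanishing) (auto simp: mult.commute)
      also have "int_combination (H2_mod_torsion X) b2 \<eta> (\<lambda>i. - ?k i) =
          int_combination (H2_mod_torsion X) b2 \<tau> (\<lambda>i. d i * - ?k i)"
        by (rule L.int_combination_scaled) (simp_all add: \<tau> \<eta> d_def)
      finally show "poly_eval ?H (\<lambda>i. - of_int (d i) + - of_int (d i) * of_nat (k i)) = 0"
        using H(3)[where k = "\<lambda>i. d i * - ?k i"] by (simp add: algebra_simps)
    next
      have "inv\<^bsub>H2_mod_torsion X\<^esub> c1 = int_combination (H2_mod_torsion X) b2 \<tau> (\<lambda>i. - N i)"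
        unfolding c1_eq by (rule L.int_combination_uminus[OF \<tau>, symmetric])
      then have "poly_eval ?H (\<lambda>i. of_int (- N i)) \<noteq> 0"
        using nonzero H(3)[where k = "\<lambda>i. - N i"] by simp
      also have "poly_eval ?H (\<lambda>i. of_int (- N i)) = poly_eval ?H (\<lambda>i. - of_int (d i) + - of_int (d i) * of_nat K)"
      proof (rule poly_eval_cong[OF H(1)])
        fix i assume "i \<in> {..<b2}"
        then have "N i = d i * (int K + 1)" using d[of i] K by simp
        then have "- N i = - d i + - d i * int K" by (simp add: algebra_simps)
        then have "rat_of_int (- N i) = of_int (- d i + - d i * int K)" by (simp only:)
        then show "rat_of_int (- N i) = - of_int (d i) + - of_int (d i) * of_nat K" by simp
      qed
      finally show "poly_eval ?H (\<lambda>i. - of_int (d i) + - of_int (d i) * of_nat K) \<noteq> 0" .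
    qed
    then have "int (b2 * K) \<le> int (total_degree ?H)" by (simp only: of_nat_le_iff) simp
    then show ?thesis by (simp only: of_nat_mult K)
  qed simp
  with H(2) show ?thesis by linarith
qed

end
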